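(* Let $\mathcal{S}$ be a set of $n\ge 1$ coins of identical appearance, among which there may be some counterfeit (fake) coins (any number of them, from $0$ to $n$, this number being unknown in advance), where the fakes are heavier (or: lighter) than the normal coins. Let $g(n)$ be the least number of weighings on a balance needed to sort $\mathcal{S}$ into normal coins and fakes in the worst case, assuming that additional coins known to be normal are available if needed. Then for every $n\neq 3$, $$\lceil n\cdot \log_3 2\rceil \;\le\; g(n)\;\le\; \lceil 7n/11\rceil ,$$ while in the exceptional case $n=3$ one has $g(3)=3$.
   Context: Coins are distinguishable by labels. All normal coins have one common weight and all fake coins have another common weight; the numerical values of the weights are not known, but it is known in advance whether fakes are heavier or lighter than normal coins (the two cases are symmetric). A weighing places two disjoint finite sets of coins (from $\mathcal{S}$ and, if desired, from the supply of additional coins known to be normal) on the left and right pans of a two-pan balance; it reveals only which of the three outcomes holds: left heavier, left lighter, or equal total weight. Weighings are adaptive: each may depend on the outcomes of the previous ones. A strategy sorts $\mathcal{S}$ with at most $k$ weighings if, for every subset $F\subseteq\mathcal{S}$ of fakes (including $F=\varnothing$ and $F=\mathcal{S}$) and whatever the weights are, the outcomes of at most $k$ weighings determine $F$. $g(n)$ is the least such $k$. *)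

theory Defs
  imports Complex_Main
begin

datatype bias = Heavier | Lighter

text \<open>The coins under investigation are the coins \<open>Given x\<close> with \<open>x\<close> in a set \<open>S\<close>; the coins
  \<open>Spare i\<close> form an unlimited supply of coins known to be normal.\<close>

datatype 'a coin = Given 'a | Spare nat

datatype outcome = Left_Heavier | Left_Lighter | Balanced

text \<open>An adaptive strategy: \<open>Weigh L R\<close> puts \<open>L\<close> on the left pan and \<open>R\<close> on the right one, and
  continues with one of three strategies, for the outcomes \<open>Left_Heavier\<close>, \<open>Left_Lighter\<close> and
  \<open>Balanced\<close> in this order.\<close>

datatype 'a strategy =
    Stop
  | Weigh "'a coin set" "'a coin set" "'a strategy" "'a strategy" "'a strategy"

definition available :: "'a set \<Rightarrow> 'a coin set" where
  "available S = Given ` S \<union> range Spare"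

primrec legal :: "'a set \<Rightarrow> 'a strategy \<Rightarrow> bool" where
  "legal S Stop \<longleftrightarrow> True"
| "legal S (Weigh L R t1 t2 t3) \<longleftrightarrow>
     finite L \<and> finite R \<and> L \<subseteq> available S \<and> R \<subseteq> available S \<and> L \<inter> R = {} \<and>
     legal S t1 \<and> legal S t2 \<and> legal S t3"

text \<open>Throughout, \<open>F\<close> is the set of fakes, \<open>a\<close> the weight of a normal coin and \<open>b\<close> the weight of
  a fake.\<close>

fun coin_weight :: "'a set \<Rightarrow> real \<Rightarrow> real \<Rightarrow> 'a coin \<Rightarrow> real" where
  "coin_weight F a b (Given x) = (if x \<in> F then b else a)"
| "coin_weight F a b (Spare i) = a"

definition admissible :: "bias \<Rightarrow> real \<Rightarrow> real \<Rightarrow> bool" where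
  "admissible d a b \<longleftrightarrow> 0 < a \<and> 0 < b \<and> (case d of Heavier \<Rightarrow> a < b | Lighter \<Rightarrow> b < a)"

definition weighing ::
    "'a set \<Rightarrow> real \<Rightarrow> real \<Rightarrow> 'a coin set \<Rightarrow> 'a coin set \<Rightarrow> outcome" where
  "weighing F a b L R =
     (let l = sum (coin_weight F a b) L; r = sum (coin_weight F a b) R
      in if r < l then Left_Heavier else if l < r then Left_Lighter else Balanced)"

primrec outcomes :: "'a set \<Rightarrow> real \<Rightarrow> real \<Rightarrow> 'a strategy \<Rightarrow> outcome list" where
  "outcomes F a b Stop = []"
| "outcomes F a b (Weigh L R t1 t2 t3) =
     weighing F a b L R #
       (case weighing F a b L R of
          Left_Heavier \<Rightarrow> outcomes F a b t1
        | Left_Lighter \<Rightarrow> outcomes F a b t2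
        | Balanced \<Rightarrow> outcomes F a b t3)"

text \<open>The weights are unknown, so equal outcomes must imply equal sets of fakes even when they
  arise from different weights.\<close>

definition sorts_within :: "bias \<Rightarrow> 'a set \<Rightarrow> nat \<Rightarrow> 'a strategy \<Rightarrow> bool" where
  "sorts_within d S k t \<longleftrightarrow>
     legal S t \<and>
     (\<forall>F a b. F \<subseteq> S \<longrightarrow> admissible d a b \<longrightarrow> length (outcomes F a b t) \<le> k) \<and>
     (\<forall>F F' a b a' b'.
        F \<subseteq> S \<longrightarrow> F' \<subseteq> S \<longrightarrow> admissible d a b \<longrightarrow> admissible d a' b' \<longrightarrow>
        outcomes F a b t = outcomes F' a' b' t \<longrightarrow> F = F')"

text \<open>For finite \<open>S\<close> the minimum exists: comparing each coin with a normal one sorts \<open>S\<close> within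
  \<open>card S\<close> weighings.\<close>

definition min_weighings :: "bias \<Rightarrow> 'a set \<Rightarrow> nat" where
  "min_weighings d S = (LEAST k. \<exists>t. sorts_within d S k t)"

end

(*
  Lower bounds: k weighings have at most 3^k outcome sequences, while there are 2^n sets of fakes.
  For three coins, let the weights of normal and fake coins be nearly equal. Then each first
  weighing has an outcome shared by at least four of the eight sets of fakes, too many for a single
  further weighing.

  Upper bounds: 11 coins can be sorted with 7 weighings, and sorting disjoint sets of coins one
  after the other reduces n to n - 11. The remainders modulo 11 are handled by sorting 1, 4, 6 and 9
  coins with 1, 3, 4 and 6 weighings; the remainder 3, for which 2 weighings do not suffice, is
  replaced by 14 coins and 9 weighings. A weighing with equally many coins on both pans compares the
  numbers of fakes on the pans, so a strategy is verified by tracking the finite set of fake/normal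
  patterns that are compatible with the outcomes.
*)

theory Submission
  imports Defs
begin

section \<open>Combining strategies\<close>

text \<open>Every coin contributes \<open>a\<close> and every fake an extra \<open>b - a\<close>, so
  only the sizes of the pans and the numbers of fakes on them matter.\<close>

lemma sum_coin_weight:
  assumes "finite C"
  shows "sum (coin_weight F a b) C = a * card C + (b - a) * card {x \<in> F. Given x \<in> C}"
  using assms
proof induction
  case (insert c C)
  \<comment> \<open>\<open>F\<close> may be infinite, but \<open>Given\<close> maps the fakes on the
    pan injectively into the finite set \<open>C\<close>.\<close>
  have fin: "finite {x \<in> F. Given x \<in> C}"
    by (rule finite_imageD[of Given]) (auto intro: finite_subset[OF _ insert(1)] inj_onI)
  show ?case
  proof (cases "\<exists>x\<in>F. c = Given x")
    case True
    then obtain x where "x \<in> F" "c = Given x" by blast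
    moreover from this have "{y \<in> F. Given y \<in> insert c C} = insert x {y \<in> F. Given y \<in> C}" by auto
    ultimately show ?thesis using insert fin by (simp add: algebra_simps)
  next
    case False
    then have "coin_weight F a b c = a" by (cases c) auto
    moreover have "{y \<in> F. Given y \<in> insert c C} = {y \<in> F. Given y \<in> C}" using False by auto
    ultimately show ?thesis using insert by (simp add: algebra_simps)
  qed
qed simp

definition compare :: "nat \<Rightarrow> nat \<Rightarrow> outcome" where
  "compare l r = (if r < l then Left_Heavier else if l < r then Left_Lighter else Balanced)"

text \<open>The direction in which the balance tips if \<open>compare\<close> says which pan has more fakes;
  an involution.\<close>

definition toward :: "bias \<Rightarrow> outcome \<Rightarrow> outcome" where
  "toward d q = (case d of Heavier \<Rightarrow> q
     | Lighter \<Rightarrow> (case q of Left_Heavier \<Rightarrow> Left_Lighter | Left_Lighter \<Rightarrow> Left_Heavier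
         | Balanced \<Rightarrow> Balanced))"

text \<open>With pans of equal size the terms in \<open>a\<close> cancel, and the pans differ by
  \<open>b - a\<close> times the difference of the fake counts. The bias fixes the sign of
  \<open>b - a\<close>, so the outcome does not depend on the weights.\<close>

lemma weighing_eq_compare:
  assumes "finite A" "finite B" "card A = card B" "admissible d a b"
  shows "weighing F a b A B =
    toward d (compare (card {x \<in> F. Given x \<in> A}) (card {x \<in> F. Given x \<in> B}))"
  using assms
  by (cases d) (auto simp: weighing_def Let_def sum_coin_weight compare_def toward_def
      admissible_def mult_less_cancel_left)

text \<open>\<open>solvable d S k H\<close>: if the set of fakes is known to belong to \<open>H\<close>, then it can be
  determined within \<open>k\<close> weighings of coins from \<open>S\<close>.\<close>

definition solvable :: "bias \<Rightarrow> 'a set \<Rightarrow> nat \<Rightarrow> 'a set set \<Rightarrow> bool" where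
  "solvable d S k H \<longleftrightarrow>
     (\<exists>t. legal S t \<and>
       (\<forall>F a b. F \<in> H \<longrightarrow> admissible d a b \<longrightarrow> length (outcomes F a b t) \<le> k) \<and>
       (\<forall>F F' a b a' b'. F \<in> H \<longrightarrow> F' \<in> H \<longrightarrow> admissible d a b \<longrightarrow> admissible d a' b' \<longrightarrow>
          outcomes F a b t = outcomes F' a' b' t \<longrightarrow> F = F'))"

lemma solvable_Pow: "solvable d S k (Pow S) \<longleftrightarrow> (\<exists>t. sorts_within d S k t)"
  by (simp add: solvable_def sorts_within_def)

lemma solvableI:
  assumes "legal S t"
    and "\<And>F a b. F \<in> H \<Longrightarrow> admissible d a b \<Longrightarrow> length (outcomes F a b t) \<le> k"
    and "\<And>F F' a b a' b'. \<lbrakk>F \<in> H; F' \<in> H; admissible d a b; admissible d a' b';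
      outcomes F a b t = outcomes F' a' b' t\<rbrakk> \<Longrightarrow> F = F'"
  shows "solvable d S k H"
  unfolding solvable_def by (intro exI[of _ t] conjI allI impI assms)

lemma solvableE:
  assumes "solvable d S k H"
  obtains t where "legal S t"
    and "\<And>F a b. F \<in> H \<Longrightarrow> admissible d a b \<Longrightarrow> length (outcomes F a b t) \<le> k"
    and "\<And>F F' a b a' b'. \<lbrakk>F \<in> H; F' \<in> H; admissible d a b; admissible d a' b';
      outcomes F a b t = outcomes F' a' b' t\<rbrakk> \<Longrightarrow> F = F'"
  using assms unfolding solvable_def by metis

lemma available_mono: "S \<subseteq> S' \<Longrightarrow> available S \<subseteq> available S'"
  by (auto simp: available_def)

lemma legal_mono:
  assumes "legal S t" "S \<subseteq> S'"
  shows "legal S' t"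
  using available_mono[OF assms(2)] assms(1) by (induction t) auto

lemma solvable_mono:
  assumes "solvable d S k H" "k \<le> k'"
  shows "solvable d S k' H"
proof -
  obtain t where t: "legal S t"
      "\<And>F a b. F \<in> H \<Longrightarrow> admissible d a b \<Longrightarrow> length (outcomes F a b t) \<le> k"
      "\<And>F F' a b a' b'. \<lbrakk>F \<in> H; F' \<in> H; admissible d a b; admissible d a' b';
         outcomes F a b t = outcomes F' a' b' t\<rbrakk> \<Longrightarrow> F = F'"
    by (rule solvableE[OF assms(1)]) blast
  show ?thesis by (rule solvableI[OF t(1) order_trans[OF t(2) assms(2)] t(3)])
qed

text \<open>A strategy that is legal for \<open>A\<close> weighs only coins of \<open>A\<close> and
  normal coins, so fakes outside \<open>A\<close> never enter a sum.\<close>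

lemma outcomes_restrict:
  assumes "legal A t"
  shows "outcomes (F \<inter> A) a b t = outcomes F a b t"
proof -
  have *: "sum (coin_weight (F \<inter> A) a b) C = sum (coin_weight F a b) C" if "C \<subseteq> available A" for C
    by (rule sum.cong) (use that in \<open>auto simp: available_def\<close>)
  show ?thesis using assms
    by (induction t) (auto simp: weighing_def * split: outcome.split)
qed

text \<open>Run the strategy for \<open>A\<close>: its outcomes give \<open>F \<inter> A\<close>,
  which by assumption singles out \<open>F\<close> in \<open>H\<close>.\<close>

lemma solvable_restrict:
  assumes "solvable d A k (Pow A)" "A \<subseteq> S" "inj_on (\<lambda>F. F \<inter> A) H"
  shows "solvable d S k H"
proof -
  obtain t where t: "legal A t"
      "\<And>F a b. F \<in> Pow A \<Longrightarrow> admissible d a b \<Longrightarrow> length (outcomes F a b t) \<le> k"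
      "\<And>F F' a b a' b'. \<lbrakk>F \<in> Pow A; F' \<in> Pow A; admissible d a b; admissible d a' b';
         outcomes F a b t = outcomes F' a' b' t\<rbrakk> \<Longrightarrow> F = F'"
    by (rule solvableE[OF assms(1)]) blast
  note eq = outcomes_restrict[OF t(1)]
  show ?thesis
  proof (rule solvableI)
    show "legal S t" using t(1) assms(2) by (rule legal_mono)
    show "length (outcomes F a b t) \<le> k" if "admissible d a b" for F a b
      using t(2)[of "F \<inter> A"] that by (simp add: eq)
    show "F = F'" if "F \<in> H" "F' \<in> H" "admissible d a b" "admissible d a' b'"
        "outcomes F a b t = outcomes F' a' b' t" for F F' a b a' b'
    proof -
      have "F \<inter> A = F' \<inter> A"
        by (rule t(3)[of _ _ a b a' b']) (use that in \<open>auto simp: eq\<close>)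
      then show ?thesis using that assms(3) by (auto dest: inj_onD)
    qed
  qed
qed

section \<open>Running two strategies in succession\<close>

primrec and_then :: "'a strategy \<Rightarrow> 'a strategy \<Rightarrow> 'a strategy" where
  "and_then Stop u = u"
| "and_then (Weigh L R t1 t2 t3) u = Weigh L R (and_then t1 u) (and_then t2 u) (and_then t3 u)"

lemma legal_and_then: "legal S t \<Longrightarrow> legal S u \<Longrightarrow> legal S (and_then t u)"
  by (induction t) auto

lemma outcomes_and_then: "outcomes F a b (and_then t u) = outcomes F a b t @ outcomes F a b u"
  by (induction t) (auto split: outcome.split)

text \<open>Equal concatenations might be cut at different places. Here both runs follow the same
  path of \<open>t\<close> as long as their outcomes agree, so \<open>t\<close> ends at the same
  place in both.\<close>

lemma outcomes_and_then_eqD: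
  assumes "outcomes F a b (and_then t u) = outcomes F' a' b' (and_then t u)"
  shows "outcomes F a b t = outcomes F' a' b' t \<and> outcomes F a b u = outcomes F' a' b' u"
  using assms by (induction t) (auto split: outcome.splits)

lemma solvable_Un:
  assumes "solvable d A k (Pow A)" "solvable d B l (Pow B)"
  shows "solvable d (A \<union> B) (k + l) (Pow (A \<union> B))"
proof -
  obtain t where t: "legal A t"
      "\<And>F a b. F \<in> Pow A \<Longrightarrow> admissible d a b \<Longrightarrow> length (outcomes F a b t) \<le> k"
      "\<And>F F' a b a' b'. \<lbrakk>F \<in> Pow A; F' \<in> Pow A; admissible d a b; admissible d a' b';
         outcomes F a b t = outcomes F' a' b' t\<rbrakk> \<Longrightarrow> F = F'"
    by (rule solvableE[OF assms(1)]) blast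
  obtain u where u: "legal B u"
      "\<And>F a b. F \<in> Pow B \<Longrightarrow> admissible d a b \<Longrightarrow> length (outcomes F a b u) \<le> l"
      "\<And>F F' a b a' b'. \<lbrakk>F \<in> Pow B; F' \<in> Pow B; admissible d a b; admissible d a' b';
         outcomes F a b u = outcomes F' a' b' u\<rbrakk> \<Longrightarrow> F = F'"
    by (rule solvableE[OF assms(2)]) blast
  note eq = outcomes_restrict[OF t(1)] outcomes_restrict[OF u(1)]
  show ?thesis
  proof (rule solvableI)
    show "legal (A \<union> B) (and_then t u)"
      using legal_mono[OF t(1), of "A \<union> B"] legal_mono[OF u(1), of "A \<union> B"]
      by (simp add: legal_and_then)
    show "length (outcomes F a b (and_then t u)) \<le> k + l" if "admissible d a b" for F a b
      using add_mono[OF t(2)[of "F \<inter> A" a b] u(2)[of "F \<inter> B" a b]] that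
      by (simp add: outcomes_and_then eq)
    show "F = F'" if "F \<in> Pow (A \<union> B)" "F' \<in> Pow (A \<union> B)" "admissible d a b" "admissible d a' b'"
        "outcomes F a b (and_then t u) = outcomes F' a' b' (and_then t u)" for F F' a b a' b'
    proof -
      note oc = outcomes_and_then_eqD[OF that(5)]
      have "F \<inter> A = F' \<inter> A"
        by (rule t(3)[of _ _ a b a' b']) (use that oc in \<open>auto simp: eq\<close>)
      moreover have "F \<inter> B = F' \<inter> B"
        by (rule u(3)[of _ _ a b a' b']) (use that oc in \<open>auto simp: eq\<close>)
      ultimately show ?thesis using that(1,2) by blast
    qed
  qed
qed

section \<open>Weighings padded with normal coins\<close>

lemma card_pad:
  assumes "finite A"
  shows "card (Given ` A \<union> Spare ` {..<j}) = card A + j"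
proof -
  have "card (Given ` A \<union> Spare ` {..<j}) = card (Given ` A) + card (Spare ` {..<j} :: 'a coin set)"
    by (rule card_Un_disjoint) (use assms in auto)
  then show ?thesis by (simp add: card_image inj_on_def)
qed

text \<open>Padding the pan that holds fewer coins with coins known to be normal makes the outcome
  independent of the weights.\<close>

lemma solvable_weigh:
  assumes AB: "finite A" "finite B" "A \<subseteq> S" "B \<subseteq> S" "A \<inter> B = {}"
  assumes sub: "\<And>q. solvable d S k {F \<in> H. compare (card (F \<inter> A)) (card (F \<inter> B)) = q}"
  shows "solvable d S (Suc k) H"
proof -
  \<comment> \<open>Truncated subtraction pads only the smaller pan, up to the size of the larger
    one.\<close>
  define pa where "pa = Given ` A \<union> Spare ` {..<card B - card A}"
  define pb where "pb = Given ` B \<union> Spare ` {..<card A - card B}"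
  define H' where "H' q = {F \<in> H. toward d (compare (card (F \<inter> A)) (card (F \<inter> B))) = q}" for q
  have fin: "finite pa" "finite pb" and card: "card pa = card pb"
    using AB by (auto simp: pa_def pb_def card_pad)
  have wg: "weighing F a b pa pb = toward d (compare (card (F \<inter> A)) (card (F \<inter> B)))"
    if "admissible d a b" for F a b
  proof -
    have "{x \<in> F. Given x \<in> pa} = F \<inter> A" "{x \<in> F. Given x \<in> pb} = F \<inter> B"
      by (auto simp: pa_def pb_def)
    then show ?thesis using weighing_eq_compare[OF fin card that] by simp
  qed
  \<comment> \<open>Since \<open>toward d\<close> is an involution, each class for an actual outcome
    is one of the classes of \<open>compare\<close> in the assumption.\<close>
  have "toward d p = q \<longleftrightarrow> p = toward d q" for p q
    by (cases d; cases p; cases q) (auto simp: toward_def)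
  then have "solvable d S k (H' q)" for q
    unfolding H'_def using sub by simp
  then obtain t where "\<And>q. legal S (t q) \<and>
       (\<forall>F a b. F \<in> H' q \<longrightarrow> admissible d a b \<longrightarrow> length (outcomes F a b (t q)) \<le> k) \<and>
       (\<forall>F F' a b a' b'. F \<in> H' q \<longrightarrow> F' \<in> H' q \<longrightarrow> admissible d a b \<longrightarrow> admissible d a' b' \<longrightarrow>
          outcomes F a b (t q) = outcomes F' a' b' (t q) \<longrightarrow> F = F')"
    unfolding solvable_def by metis
  then have t: "legal S (t q)"
      "F \<in> H' q \<Longrightarrow> admissible d a b \<Longrightarrow> length (outcomes F a b (t q)) \<le> k"
      "\<lbrakk>F \<in> H' q; F' \<in> H' q; admissible d a b; admissible d a' b';
         outcomes F a b (t q) = outcomes F' a' b' (t q)\<rbrakk> \<Longrightarrow> F = F'" for q F F' a b a' b'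
    by blast+
  define u where "u = Weigh pa pb (t Left_Heavier) (t Left_Lighter) (t Balanced)"
  have u: "outcomes F a b u = q # outcomes F a b (t q)"
    if "F \<in> H' q" "admissible d a b" for F a b q
    using that by (auto simp: u_def wg H'_def split: outcome.split)
  have mem: "\<exists>q. F \<in> H' q" if "F \<in> H" for F using that by (auto simp: H'_def)
  show ?thesis
  proof (rule solvableI)
    show "legal S u"
      using AB fin t by (auto simp: u_def pa_def pb_def available_def)
    show "length (outcomes F a b u) \<le> Suc k" if F: "F \<in> H" and ab: "admissible d a b" for F a b
    proof -
      obtain q where q: "F \<in> H' q" using mem[OF F] by blast
      then show ?thesis using u[OF q ab] t(2)[OF q ab] by simp
    qed
    show "F = F'" if F: "F \<in> H" "F' \<in> H" and ab: "admissible d a b" "admissible d a' b'"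
        and eq: "outcomes F a b u = outcomes F' a' b' u" for F F' a b a' b'
    proof -
      obtain q q' where q: "F \<in> H' q" "F' \<in> H' q'"
        using mem[OF F(1)] mem[OF F(2)] by blast
      then have "q = q'" "outcomes F a b (t q) = outcomes F' a' b' (t q)"
        using eq u[OF q(1) ab(1)] u[OF q(2) ab(2)] by auto
      then show ?thesis using t(3)[OF q(1) _ ab] q(2) by blast
    qed
  qed
qed

section \<open>Checking explicit plans\<close>

datatype pan = L | R | N

text \<open>Coins are numbered in the order in which they are first weighed. \<open>Use cs\<close> puts coin \<open>i\<close>
  where \<open>cs ! i\<close> says (\<open>N\<close> and missing entries: nowhere) and continues with the first, second or
  third plan if the left pan has more, fewer or equally many fakes. \<open>Sort p\<close> stops planning: it
  remains to sort the coins \<open>p\<close> and the coins not weighed yet, which must be possible by a known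
  bound, and the statuses of the coins \<open>p\<close> must determine those of all weighed coins.\<close>

datatype plan = Sort "nat list" | Use "pan list" plan plan plan

text \<open>\<open>l\<close> and \<open>r\<close> accumulate the fakes on the two pans, so that
  weighings can be evaluated on lists of statuses.\<close>

fun tilt :: "pan list \<Rightarrow> bool list \<Rightarrow> nat \<Rightarrow> nat \<Rightarrow> outcome" where
  "tilt (c # cs) (b # v) l r =
     (if b then (case c of L \<Rightarrow> tilt cs v (Suc l) r | R \<Rightarrow> tilt cs v l (Suc r) | N \<Rightarrow> tilt cs v l r)
      else tilt cs v l r)"
| "tilt _ _ l r = compare l r"

text \<open>Coins receive a status only when they are first weighed; this keeps the enumerated lists
  short.\<close>

fun extend :: "nat \<Rightarrow> bool list list \<Rightarrow> bool list list" where
  "extend 0 V = V"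
| "extend (Suc f) V = extend f (map (\<lambda>v. v @ [True]) V @ map (\<lambda>v. v @ [False]) V)"

text \<open>\<open>works caps t k m r V\<close> checks that \<open>t\<close> needs at most \<open>k\<close> more weighings if \<open>m\<close> coins have
  been weighed, their possible fake statuses are the rows of \<open>V\<close>, \<open>r\<close> coins are still unweighed,
  and any \<open>i\<close> coins can be sorted within \<open>caps ! i\<close> weighings.\<close>

primrec works :: "nat list \<Rightarrow> plan \<Rightarrow> nat \<Rightarrow> nat \<Rightarrow> nat \<Rightarrow> bool list list \<Rightarrow> bool" where
  "works caps (Sort p) k m r V \<longleftrightarrow>
     distinct p \<and> list_all (\<lambda>i. i < m) p \<and> distinct (map (\<lambda>v. map (nth v) p) V) \<and>
     length p + r < length caps \<and> caps ! (length p + r) \<le> k"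
| "works caps (Use cs t1 t2 t3) k m r V \<longleftrightarrow>
     (case k of 0 \<Rightarrow> False | Suc k' \<Rightarrow>
       (let f = length cs - m; V' = extend f V in
         f \<le> r \<and>
         works caps t1 k' (m + f) (r - f) (filter (\<lambda>v. tilt cs v 0 0 = Left_Heavier) V') \<and>
         works caps t2 k' (m + f) (r - f) (filter (\<lambda>v. tilt cs v 0 0 = Left_Lighter) V') \<and>
         works caps t3 k' (m + f) (r - f) (filter (\<lambda>v. tilt cs v 0 0 = Balanced) V')))"

definition fakes_in :: "'a set \<Rightarrow> 'a list \<Rightarrow> bool list" where
  "fakes_in F xs = map (\<lambda>x. x \<in> F) xs"

text \<open>What a state of \<open>works\<close> stands for: \<open>xs\<close> lists the weighed
  coins, one for each column of \<open>V\<close>, and nothing is known about the coins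
  \<open>ys\<close>.\<close>

definition hyps :: "'a list \<Rightarrow> 'a list \<Rightarrow> bool list list \<Rightarrow> 'a set set" where
  "hyps xs ys V = {F. F \<subseteq> set (xs @ ys) \<and> fakes_in F xs \<in> set V}"

definition on_pan :: "pan \<Rightarrow> pan list \<Rightarrow> 'a list \<Rightarrow> 'a set" where
  "on_pan c cs xs = {x. (c, x) \<in> set (zip cs xs)}"

lemma on_pan_subset: "on_pan c cs xs \<subseteq> set xs"
  by (auto simp: on_pan_def dest: set_zip_rightD)

lemma finite_on_pan: "finite (on_pan c cs xs)"
  by (rule finite_subset[OF on_pan_subset]) simp

lemma on_pan_Cons: "on_pan c (c' # cs) (x # xs) = (if c = c' then {x} else {}) \<union> on_pan c cs xs"
  by (auto simp: on_pan_def)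

lemma on_pan_disjoint:
  assumes "distinct xs" "c \<noteq> c'"
  shows "on_pan c cs xs \<inter> on_pan c' cs xs = {}"
  using assms
proof (induction cs xs rule: list_induct2')
  case (4 c cs x xs)
  then show ?case using on_pan_subset[of _ cs xs] by (auto simp: on_pan_Cons)
qed (auto simp: on_pan_def)

lemma tilt_eq_compare:
  assumes "distinct xs"
  shows "tilt cs (fakes_in F xs) l r =
    compare (l + card (F \<inter> on_pan L cs xs)) (r + card (F \<inter> on_pan R cs xs))"
  using assms
proof (induction cs xs arbitrary: l r rule: list_induct2')
  case (4 c cs x xs)
  have "x \<notin> on_pan c' cs xs" for c' using 4(2) on_pan_subset[of c' cs xs] by auto
  then have card: "card (F \<inter> on_pan c' (c # cs) (x # xs)) =
      (if x \<in> F \<and> c' = c then 1 else 0) + card (F \<inter> on_pan c' cs xs)" for c'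
    by (auto simp: on_pan_Cons Int_insert_right finite_on_pan)
  have "fakes_in F (x # xs) = (x \<in> F) # fakes_in F xs" by (simp add: fakes_in_def)
  then show ?case using 4 card[of L] card[of R] by (cases c) simp_all
qed (auto simp: fakes_in_def on_pan_def)

text \<open>Nothing is known about an unweighed coin, so listing both of its statuses excludes no
  set of fakes.\<close>

lemma hyps_extend:
  assumes "f \<le> length ys" "distinct (xs @ ys)"
  shows "hyps xs ys V = hyps (xs @ take f ys) (drop f ys) (extend f V)"
  using assms
proof (induction f arbitrary: xs ys V)
  case (Suc f)
  then obtain y ys' where ys: "ys = y # ys'" by (cases ys) auto
  have "hyps xs ys V = hyps (xs @ [y]) ys' (map (\<lambda>v. v @ [True]) V @ map (\<lambda>v. v @ [False]) V)"
    by (auto simp: hyps_def ys fakes_in_def)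
  also have "\<dots> = hyps (xs @ take (Suc f) ys) (drop (Suc f) ys) (extend (Suc f) V)"
    using Suc.IH[of ys' "xs @ [y]"] Suc.prems by (simp add: ys)
  finally show ?case .
qed simp

lemma length_extend:
  assumes "\<forall>v\<in>set V. length v = m"
  shows "\<forall>v\<in>set (extend f V). length v = m + f"
  using assms
proof (induction f arbitrary: m V)
  case (Suc f)
  have "\<forall>v\<in>set (map (\<lambda>v. v @ [True]) V @ map (\<lambda>v. v @ [False]) V). length v = Suc m"
    using Suc.prems by auto
  from Suc.IH[OF this] show ?case by simp
qed simp

text \<open>Which plan follows which outcome is forgotten here, so that the soundness proof can
  treat an arbitrary outcome \<open>q\<close>.\<close>

lemma works_Use:
  assumes "works caps (Use cs t1 t2 t3) k m r V"
  obtains k' f where "k = Suc k'" "f \<le> r"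
    "\<forall>q. \<exists>t\<in>{t1, t2, t3}.
       works caps t k' (m + f) (r - f) (filter (\<lambda>v. tilt cs v 0 0 = q) (extend f V))"
proof (cases k)
  case (Suc k')
  \<comment> \<open>\<open>length cs - m\<close> is the number of coins weighed for the first time;
    truncation makes it 0 if \<open>cs\<close> lists earlier coins only.\<close>
  have "\<exists>t\<in>{t1, t2, t3}. works caps t k' (m + (length cs - m)) (r - (length cs - m))
     (filter (\<lambda>v. tilt cs v 0 0 = q) (extend (length cs - m) V))" for q
    by (cases q) (use assms Suc in \<open>auto simp: Let_def\<close>)
  moreover have "length cs - m \<le> r" using assms Suc by (simp add: Let_def)
  ultimately show thesis using that[OF Suc] by blast
qed (use assms in simp)

text \<open>Soundness of the checker, by induction on the plan: \<open>Use\<close> is one padded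
  weighing, and \<open>Sort\<close> passes to coins whose statuses determine all others.\<close>

lemma solvable_hyps:
  fixes xs ys :: "'a list"
  assumes caps: "\<And>A :: 'a set. finite A \<Longrightarrow> card A < length caps \<Longrightarrow> solvable d A (caps ! card A) (Pow A)"
  assumes "works caps t k (length xs) (length ys) V" "distinct (xs @ ys)"
    "\<forall>v\<in>set V. length v = length xs" "set (xs @ ys) \<subseteq> S"
  shows "solvable d S k (hyps xs ys V)"
  using assms(2-)
proof (induction t arbitrary: k xs ys V)
  case (Sort p)
  define A where "A = set (map (nth xs) p) \<union> set ys"
  have p: "distinct p" "\<And>i. i \<in> set p \<Longrightarrow> i < length xs" "distinct (map (\<lambda>v. map (nth v) p) V)"
    using Sort.prems(1) by (auto simp: list_all_iff)
  have dist: "distinct (map (nth xs) p)"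
    using p Sort.prems(2) by (auto simp: distinct_map inj_on_def nth_eq_iff_index_eq)
  have sub: "set (map (nth xs) p) \<subseteq> set xs" using p(2) by auto
  then have "distinct (map (nth xs) p @ ys)" using dist Sort.prems(2) by auto
  from distinct_card[OF this] have "card A = length p + length ys" by (simp add: A_def)
  then have "solvable d A k (Pow A)"
    using Sort.prems(1) by (auto intro: solvable_mono[OF caps] simp: A_def)
  moreover have "A \<subseteq> S" using sub Sort.prems(4) by (auto simp: A_def)
  moreover have "inj_on (\<lambda>F. F \<inter> A) (hyps xs ys V)"
  proof (rule inj_onI)
    fix F F' assume F: "F \<in> hyps xs ys V" "F' \<in> hyps xs ys V" and eq: "F \<inter> A = F' \<inter> A"
    have "xs ! i \<in> F \<longleftrightarrow> xs ! i \<in> F'" if "i \<in> set p" for i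
      using eq that by (auto simp: A_def)
    then have "map (nth (fakes_in F xs)) p = map (nth (fakes_in F' xs)) p"
      using p(2) by (simp add: fakes_in_def)
    \<comment> \<open>The distinctness test in \<open>works\<close> makes the statuses of the coins
      \<open>p\<close> identify a row of \<open>V\<close>.\<close>
    moreover have "inj_on (\<lambda>v. map (nth v) p) (set V)" using p(3) by (simp add: distinct_map)
    ultimately have "fakes_in F xs = fakes_in F' xs"
      using F by (auto simp: hyps_def dest: inj_onD)
    then have "x \<in> F \<longleftrightarrow> x \<in> F'" if "x \<in> set xs" for x using that by (simp add: fakes_in_def)
    moreover have "x \<in> F \<longleftrightarrow> x \<in> F'" if "x \<in> set ys" for x using that eq by (auto simp: A_def)
    ultimately show "F = F'" using F by (auto simp: hyps_def)
  qed
  ultimately show ?case by (rule solvable_restrict)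
next
  case (Use cs t1 t2 t3)
  obtain k' f where k: "k = Suc k'" and f: "f \<le> length ys"
    and sub: "\<forall>q. \<exists>t\<in>{t1, t2, t3}. works caps t k' (length xs + f) (length ys - f)
       (filter (\<lambda>v. tilt cs v 0 0 = q) (extend f V))"
    using Use.prems(1) by (rule works_Use)
  define xs' where "xs' = xs @ take f ys"
  define ys' where "ys' = drop f ys"
  have eq: "xs' @ ys' = xs @ ys" by (simp add: xs'_def ys'_def)
  have len: "length xs' = length xs + f" "length ys' = length ys - f"
    using f by (simp_all add: xs'_def ys'_def)
  have dist: "distinct xs'" using Use.prems(2) by (metis eq distinct_append)
  have S: "set xs' \<subseteq> S" using Use.prems(4) eq by (metis set_append le_sup_iff)
  have "solvable d S (Suc k') (hyps xs' ys' (extend f V))"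
  proof (rule solvable_weigh)
    show "on_pan L cs xs' \<inter> on_pan R cs xs' = {}" using dist by (simp add: on_pan_disjoint)
    fix q
    have "{F \<in> hyps xs' ys' (extend f V).
        compare (card (F \<inter> on_pan L cs xs')) (card (F \<inter> on_pan R cs xs')) = q} =
      hyps xs' ys' (filter (\<lambda>v. tilt cs v 0 0 = q) (extend f V))"
      by (auto simp: hyps_def tilt_eq_compare[OF dist])
    moreover have "solvable d S k' (hyps xs' ys' (filter (\<lambda>v. tilt cs v 0 0 = q) (extend f V)))"
    proof -
      obtain t where t: "t \<in> {t1, t2, t3}" "works caps t k' (length xs') (length ys')
          (filter (\<lambda>v. tilt cs v 0 0 = q) (extend f V))"
        using spec[OF sub, of q] by (auto simp: len)
      have "\<forall>v\<in>set (filter (\<lambda>v. tilt cs v 0 0 = q) (extend f V)). length v = length xs'"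
        using length_extend[OF Use.prems(3)] by (simp add: len)
      then show ?thesis using t Use.IH[OF _ _ _ _] Use.prems(2,4) unfolding eq[symmetric] by blast
    qed
    ultimately show "solvable d S k' {F \<in> hyps xs' ys' (extend f V).
        compare (card (F \<inter> on_pan L cs xs')) (card (F \<inter> on_pan R cs xs')) = q}"
      by simp
  qed (use S on_pan_subset[of _ cs xs'] in \<open>auto simp: finite_on_pan\<close>)
  then show ?case using hyps_extend[OF f Use.prems(2)] by (simp add: k xs'_def ys'_def)
qed

lemma works_imp_solvable:
  fixes S :: "'a set"
  assumes "\<And>A :: 'a set. finite A \<Longrightarrow> card A < length caps \<Longrightarrow> solvable d A (caps ! card A) (Pow A)"
  assumes "works caps t k 0 (card S) [[]]" "finite S"
  shows "solvable d S k (Pow S)"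
proof -
  obtain ys where ys: "set ys = S" "distinct ys" using finite_distinct_list[OF assms(3)] by blast
  \<comment> \<open>The empty row is the one status pattern of no coins. Listing it leaves every
    subset possible, whereas \<open>[]\<close> would leave none.\<close>
  have "hyps [] ys [[]] = Pow S" by (auto simp: hyps_def fakes_in_def ys)
  moreover have "solvable d S k (hyps [] ys [[]])"
    by (rule solvable_hyps[OF assms(1)]) (use assms(2) ys distinct_card[OF ys(2)] in auto)
  ultimately show ?thesis by simp
qed

section \<open>Lower bounds\<close>

text \<open>The tree may be deeper than \<open>k\<close>; only the branches taken by sets in
  \<open>H\<close> are bounded. The induction therefore splits \<open>H\<close> by the first
  outcome, each part contributing at most a third of \<open>3 ^ k\<close>.\<close>

lemma card_outcomes_le:
  assumes "finite H" "\<And>F. F \<in> H \<Longrightarrow> length (outcomes F a b t) \<le> k"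
  shows "card ((\<lambda>F. outcomes F a b t) ` H) \<le> 3 ^ k"
  using assms
proof (induction t arbitrary: H k)
  case Stop
  have "card ((\<lambda>F. outcomes F a b Stop) ` H) \<le> card {[] :: outcome list}"
    by (intro card_mono) auto
  then show ?case by (simp add: order_trans[OF _ one_le_power])
next
  case (Weigh A B t1 t2 t3)
  show ?case
  proof (cases "H = {}")
    case False
    then obtain k' where k: "k = Suc k'"
      using Weigh.prems(2) by (cases k) auto
    define P where "P q t = (\<lambda>F. q # outcomes F a b t) ` {F \<in> H. weighing F a b A B = q}" for q t
    have P: "card (P q t) \<le> 3 ^ k'"
      if IH: "\<And>H k. finite H \<Longrightarrow> (\<And>F. F \<in> H \<Longrightarrow> length (outcomes F a b t) \<le> k) \<Longrightarrow>
            card ((\<lambda>F. outcomes F a b t) ` H) \<le> 3 ^ k"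
        and eq: "\<And>F. weighing F a b A B = q \<Longrightarrow>
            outcomes F a b (Weigh A B t1 t2 t3) = q # outcomes F a b t" for q t
    proof -
      let ?H = "{F \<in> H. weighing F a b A B = q}"
      have "P q t = Cons q ` (\<lambda>F. outcomes F a b t) ` ?H" by (auto simp: P_def)
      then have "card (P q t) = card ((\<lambda>F. outcomes F a b t) ` ?H)" by (simp add: card_image)
      also have "\<dots> \<le> 3 ^ k'"
      proof (rule IH)
        show "length (outcomes F a b t) \<le> k'" if "F \<in> ?H" for F
          using Weigh.prems(2)[of F] that eq[of F] k by simp
      qed (use Weigh.prems(1) in simp)
      finally show ?thesis .
    qed
    have "(\<lambda>F. outcomes F a b (Weigh A B t1 t2 t3)) ` H \<subseteq>
        P Left_Heavier t1 \<union> P Left_Lighter t2 \<union> P Balanced t3"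
      by (auto simp: P_def split: outcome.splits)
    then have "card ((\<lambda>F. outcomes F a b (Weigh A B t1 t2 t3)) ` H) \<le>
        card (P Left_Heavier t1 \<union> P Left_Lighter t2 \<union> P Balanced t3)"
      by (rule card_mono[rotated]) (use Weigh.prems(1) in \<open>auto simp: P_def\<close>)
    also have "\<dots> \<le> card (P Left_Heavier t1) + card (P Left_Lighter t2) + card (P Balanced t3)"
      by (meson add_right_mono card_Un_le order_trans)
    also have "\<dots> \<le> 3 ^ k' + 3 ^ k' + 3 ^ k'"
      by (intro add_mono P Weigh.IH) auto
    finally show ?thesis by (simp add: k)
  qed simp
qed

section \<open>Lower bounds from one choice of weights\<close>

lemma sorts_within_length:
  assumes "sorts_within d S k t" "F \<subseteq> S" "admissible d a b"
  shows "length (outcomes F a b t) \<le> k"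
  using assms by (simp add: sorts_within_def)

lemma sorts_within_inj:
  assumes "sorts_within d S k t" "admissible d a b"
  shows "inj_on (\<lambda>F. outcomes F a b t) (Pow S)"
proof (rule inj_onI)
  fix F F' assume "F \<in> Pow S" "F' \<in> Pow S" "outcomes F a b t = outcomes F' a b t"
  with assms show "F = F'" unfolding sorts_within_def Pow_iff by metis
qed

text \<open>Normal coins weigh 10 in the lower bounds. A difference of 1 in either direction is too
  small for three fakes to offset a whole coin.\<close>

definition fake_weight :: "bias \<Rightarrow> real" where
  "fake_weight d = (case d of Heavier \<Rightarrow> 11 | Lighter \<Rightarrow> 9)"

lemma admissible_fake_weight: "admissible d 10 (fake_weight d)"
  by (cases d) (auto simp: admissible_def fake_weight_def)

lemma sorts_within_imp_power_le:
  assumes "finite S" "sorts_within d S k t"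
  shows "2 ^ card S \<le> (3 :: nat) ^ k"
proof -
  let ?o = "\<lambda>F. outcomes F 10 (fake_weight d) t"
  note adm = admissible_fake_weight[of d]
  have "2 ^ card S = card (?o ` Pow S)" 
    by (simp add: card_image[OF sorts_within_inj[OF assms(2) adm]] card_Pow assms(1))
  also have "\<dots> \<le> 3 ^ k"
    using assms(1) sorts_within_length[OF assms(2) _ adm] by (intro card_outcomes_le) auto
  finally show ?thesis .
qed

text \<open>When the pans hold different numbers of coins, at most three fakes cannot tip the balance:
  the weights of normal and fake coins differ by only a tenth.\<close>

lemma weighing_unequal_cards:
  assumes "finite A" "finite B" "card A \<noteq> card B" "finite S" "card S \<le> 3" "F \<subseteq> S"
  shows "weighing F 10 (fake_weight d) A B = compare (card A) (card B)"
proof -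
  have le: "card {x \<in> F. Given x \<in> C} \<le> 3" for C
    using card_mono[OF assms(4), of "{x \<in> F. Given x \<in> C}"] assms(5,6) by force
  show ?thesis
    using assms(1-3) le[of A] le[of B]
    by (cases d) (auto simp: weighing_def Let_def sum_coin_weight compare_def fake_weight_def)
qed

text \<open>This excludes two weighings for three coins: one further weighing separates at most
  three cases.\<close>

lemma tilt_class_ge_4:
  assumes "length cs = 3"
  shows "\<exists>q. 4 \<le> length (filter (\<lambda>v. tilt cs v 0 0 = q) (extend 3 [[]]))"
proof -
  have "\<forall>cs\<in>set (List.n_lists 3 [L, R, N]). \<exists>q\<in>{Left_Heavier, Left_Lighter, Balanced}.
      4 \<le> length (filter (\<lambda>v. tilt cs v 0 0 = q) (extend 3 [[]]))"
    by code_simp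
  moreover have "c = L \<or> c = R \<or> c = N" for c by (cases c) auto
  then have "cs \<in> set (List.n_lists 3 [L, R, N])" using assms by (auto simp: set_n_lists)
  ultimately show ?thesis by blast
qed

section \<open>The first weighing of three coins\<close>

lemma fakes_in_eq_iff:
  assumes "F \<subseteq> set xs" "F' \<subseteq> set xs"
  shows "fakes_in F xs = fakes_in F' xs \<longleftrightarrow> F = F'"
  using assms by (auto simp: fakes_in_def)

text \<open>Each subset has its own pattern, and \<open>extend\<close> lists no more patterns than
  there are subsets, so every listed pattern occurs.\<close>

lemma bij_betw_fakes_in:
  assumes "distinct xs"
  shows "bij_betw (\<lambda>F. fakes_in F xs) (Pow (set xs)) (set (extend (length xs) [[]]))"
proof -
  have len: "length (extend f V) = 2 ^ f * length V" for f V
    by (induction f arbitrary: V) auto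
  have inj: "inj_on (\<lambda>F. fakes_in F xs) (Pow (set xs))"
    by (auto simp: inj_on_def fakes_in_eq_iff)
  have "Pow (set xs) = hyps [] xs [[]]" by (auto simp: hyps_def fakes_in_def)
  also have "\<dots> = hyps xs [] (extend (length xs) [[]])"
    using hyps_extend[of "length xs" xs "[]"] assms by simp
  finally have "(\<lambda>F. fakes_in F xs) ` Pow (set xs) \<subseteq> set (extend (length xs) [[]])"
    by (auto simp: hyps_def)
  moreover have "card (set (extend (length xs) [[]])) \<le> card ((\<lambda>F. fakes_in F xs) ` Pow (set xs))"
    using card_length[of "extend (length xs) [[]]"] assms
    by (simp add: card_image[OF inj] card_Pow distinct_card len)
  ultimately have "(\<lambda>F. fakes_in F xs) ` Pow (set xs) = set (extend (length xs) [[]])"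
    by (intro card_seteq) auto
  with inj show ?thesis by (simp add: bij_betw_def)
qed

text \<open>Pans of different sizes tip the same way for all eight sets of fakes. Pans of equal size
  compare numbers of fakes, and the finite check over all 27 placements of the coins
  applies.\<close>

lemma weighing_class_ge_4:
  assumes "finite A" "finite B" "A \<inter> B = {}" "finite S" "card S = 3"
  shows "\<exists>q. 4 \<le> card {F \<in> Pow S. weighing F 10 (fake_weight d) A B = q}"
proof (cases "card A = card B")
  case False
  then have "{F \<in> Pow S. weighing F 10 (fake_weight d) A B = compare (card A) (card B)} = Pow S"
    using weighing_unequal_cards[OF assms(1,2)] assms(4,5) by auto
  then show ?thesis using assms(4,5) by (intro exI[of _ "compare (card A) (card B)"]) (simp add: card_Pow)
next
  case True
  obtain xs where xs: "set xs = S" "distinct xs" using finite_distinct_list[OF assms(4)] by blast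
  \<comment> \<open>Normal coins on the pans can be left out: the pans have equal size, so only the
    fakes decide.\<close>
  define cs where "cs = map (\<lambda>x. if Given x \<in> A then L else if Given x \<in> B then R else N) xs"
  have len: "length xs = 3" using distinct_card[OF xs(2)] xs(1) assms(5) by simp
  then obtain q where q: "4 \<le> length (filter (\<lambda>v. tilt cs v 0 0 = q) (extend 3 [[]]))"
    using tilt_class_ge_4[of cs] by (auto simp: cs_def)
  have pan: "on_pan L cs xs = {x \<in> S. Given x \<in> A}" "on_pan R cs xs = {x \<in> S. Given x \<in> B}"
    using assms(3) xs(1)
    by (auto simp: on_pan_def cs_def zip_map1 zip_same_conv_map image_iff disjoint_iff split: if_splits)
  have "weighing F 10 (fake_weight d) A B = toward d (tilt cs (fakes_in F xs) 0 0)" if "F \<subseteq> S" for F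
  proof -
    have "F \<inter> {x \<in> S. Given x \<in> C} = {x \<in> F. Given x \<in> C}" for C using that by auto
    then show ?thesis
      using weighing_eq_compare[OF assms(1,2) True admissible_fake_weight]
      by (simp add: tilt_eq_compare[OF xs(2)] pan)
  qed
  then have sub: "{F \<in> Pow S. tilt cs (fakes_in F xs) 0 0 = q} \<subseteq>
      {F \<in> Pow S. weighing F 10 (fake_weight d) A B = toward d q}"
    by auto
  have bij: "bij_betw (\<lambda>F. fakes_in F xs) (Pow S) (set (extend 3 [[]]))"
    using bij_betw_fakes_in[OF xs(2)] by (simp add: xs(1) len)
  have "distinct (extend 3 [[]])" by code_simp
  then have "length (filter (\<lambda>v. tilt cs v 0 0 = q) (extend 3 [[]])) =
      card {v \<in> set (extend 3 [[]]). tilt cs v 0 0 = q}"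
    by (simp add: distinct_length_filter Int_def conj_commute)
  also have "\<dots> = card {F \<in> Pow S. tilt cs (fakes_in F xs) 0 0 = q}"
  proof (rule bij_betw_same_card[symmetric])
    show "bij_betw (\<lambda>F. fakes_in F xs) {F \<in> Pow S. tilt cs (fakes_in F xs) 0 0 = q}
        {v \<in> set (extend 3 [[]]). tilt cs v 0 0 = q}"
      using bij unfolding bij_betw_def by (auto intro: inj_on_subset)
  qed
  also have "\<dots> \<le> card {F \<in> Pow S. weighing F 10 (fake_weight d) A B = toward d q}"
    using sub assms(4) by (intro card_mono) auto
  finally show ?thesis using q by (intro exI[of _ "toward d q"]) linarith
qed

lemma not_sorts_within_2:
  assumes S: "finite S" "card S = 3"
  shows "\<not> sorts_within d S 2 t"
proof
  assume sw: "sorts_within d S 2 t"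
  let ?b = "fake_weight d"
  note adm = admissible_fake_weight[of d]
  show False
  proof (cases t)
    case Stop
    then have "{} = S" by (intro inj_onD[OF sorts_within_inj[OF sw adm]]) auto
    then show False using S by auto
  next
    case (Weigh A B t1 t2 t3)
    then have AB: "finite A" "finite B" "A \<inter> B = {}" using sw by (auto simp: sorts_within_def)
    obtain q where q: "4 \<le> card {F \<in> Pow S. weighing F 10 ?b A B = q}"
      using weighing_class_ge_4[OF AB S] by blast
    define H where "H = {F \<in> Pow S. weighing F 10 ?b A B = q}"
    \<comment> \<open>All sets in \<open>H\<close> give the first outcome \<open>q\<close> and
      continue with the same strategy, which has one weighing left for at least four sets.\<close>
    obtain u where u: "\<And>F. F \<in> H \<Longrightarrow> outcomes F 10 ?b t = q # outcomes F 10 ?b u"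
    proof
      show "outcomes F 10 ?b t = q # outcomes F 10 ?b
          (case q of Left_Heavier \<Rightarrow> t1 | Left_Lighter \<Rightarrow> t2 | Balanced \<Rightarrow> t3)" if "F \<in> H" for F
        using that by (auto simp: H_def Weigh split: outcome.splits)
    qed
    have "length (outcomes F 10 ?b u) \<le> 1" if "F \<in> H" for F
    proof -
      have "length (outcomes F 10 ?b t) \<le> 2"
        using that by (intro sorts_within_length[OF sw _ adm]) (simp add: H_def)
      then show ?thesis using u[OF that] by simp
    qed
    then have "card ((\<lambda>F. outcomes F 10 ?b u) ` H) \<le> 3 ^ 1"
      using S by (intro card_outcomes_le) (auto simp: H_def)
    moreover have "inj_on (\<lambda>F. outcomes F 10 ?b u) H"
    proof (rule inj_onI)
      fix F F' assume F: "F \<in> H" "F' \<in> H" and eq: "outcomes F 10 ?b u = outcomes F' 10 ?b u"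
      then have "outcomes F 10 ?b t = outcomes F' 10 ?b t" using u by metis
      then show "F = F'" using F inj_onD[OF sorts_within_inj[OF sw adm]] by (simp add: H_def)
    qed
    ultimately show False using q by (simp add: card_image H_def)
  qed
qed

section \<open>Upper bounds\<close>

text \<open>Tables grow by one entry at a time, so that a plan may end with any smaller number of
  coins already settled. The \<open>itself\<close> argument fixes the type of the coins, which
  occurs only under the quantifier.\<close>

definition table_ok :: "bias \<Rightarrow> 'a itself \<Rightarrow> nat list \<Rightarrow> bool" where
  "table_ok d _ ks \<longleftrightarrow>
     (\<forall>S :: 'a set. finite S \<longrightarrow> card S < length ks \<longrightarrow> solvable d S (ks ! card S) (Pow S))"

lemma table_okD:
  fixes S :: "'a set"
  assumes "table_ok d TYPE('a) ks" "finite S" "card S = n" "n < length ks"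
  shows "solvable d S (ks ! n) (Pow S)"
  using assms(1,2,4) unfolding table_ok_def assms(3)[symmetric] by blast

lemma table_ok_zero: "table_ok d TYPE('a) [0]"
proof -
  have "solvable d {} 0 (Pow ({} :: 'a set))"
    by (rule solvableI[of _ Stop]) auto
  then show ?thesis by (auto simp: table_ok_def)
qed

lemma table_ok_snoc:
  assumes "table_ok d TYPE('a) ks"
    and "\<And>S :: 'a set. finite S \<Longrightarrow> card S = length ks \<Longrightarrow> solvable d S k (Pow S)"
  shows "table_ok d TYPE('a) (ks @ [k])"
  unfolding table_ok_def
proof (intro allI impI)
  fix S :: "'a set" assume "finite S" "card S < length (ks @ [k])"
  then show "solvable d S ((ks @ [k]) ! card S) (Pow S)"
    using assms(2)[of S] table_okD[OF assms(1), of S "card S"]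
    by (cases "card S = length ks") (simp_all add: nth_append)
qed

lemma solvable_by_plan:
  fixes S :: "'a set"
  assumes "table_ok d TYPE('a) ks" "works ks t k 0 (card S) [[]]" "finite S"
  shows "solvable d S k (Pow S)"
  by (rule works_imp_solvable[OF _ assms(2,3)]) (rule table_okD[OF assms(1) _ refl])

lemma table_ok_snoc_plan:
  assumes "table_ok d TYPE('a) ks" "length ks = n" "works ks t k 0 n [[]]"
  shows "table_ok d TYPE('a) (ks @ [k])"
  using assms(1)
proof (rule table_ok_snoc)
  fix S :: "'a set" assume "finite S" "card S = length ks"
  then show "solvable d S k (Pow S)"
    using solvable_by_plan[OF assms(1), of t k S] assms(2,3) by simp
qed

lemma solvable_add:
  fixes S :: "'a set"
  assumes "\<And>A :: 'a set. finite A \<Longrightarrow> card A = i \<Longrightarrow> solvable d A k (Pow A)"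
    and "\<And>A :: 'a set. finite A \<Longrightarrow> card A = j \<Longrightarrow> solvable d A l (Pow A)"
    and "finite S" "card S = i + j"
  shows "solvable d S (k + l) (Pow S)"
proof -
  obtain A where A: "A \<subseteq> S" "card A = i"
    using obtain_subset_with_card_n[of i S] assms(4) by auto
  then have "card (S - A) = j" using assms(3,4) by (simp add: card_Diff_subset finite_subset)
  moreover have "finite A" using A(1) assms(3) by (rule finite_subset)
  ultimately have "solvable d (A \<union> (S - A)) (k + l) (Pow (A \<union> (S - A)))"
    using A(2) assms(3) by (intro solvable_Un[OF assms(1) assms(2)] finite_Diff)
  moreover have "A \<union> (S - A) = S" using A(1) by blast
  ultimately show ?thesis by simp
qed

lemma table_ok_snoc_add:
  assumes "table_ok d TYPE('a) ks" "i + j = length ks" "0 < i" "0 < j"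
  shows "table_ok d TYPE('a) (ks @ [ks ! i + ks ! j])"
  using assms(1)
proof (rule table_ok_snoc)
  fix S :: "'a set" assume S: "finite S" "card S = length ks"
  show "solvable d S (ks ! i + ks ! j) (Pow S)"
  proof (rule solvable_add)
    show "solvable d A (ks ! i) (Pow A)" if "finite A" "card A = i" for A :: "'a set"
      using table_okD[OF assms(1) that] assms(2,4) by simp
    show "solvable d A (ks ! j) (Pow A)" if "finite A" "card A = j" for A :: "'a set"
      using table_okD[OF assms(1) that] assms(2,3) by simp
  qed (use S assms(2) in simp_all)
qed

text \<open>The test for \<open>Sort []\<close> compares empty projections of the rows, so it
  accepts only if at most one pattern is left.\<close>

abbreviation Last :: "pan list \<Rightarrow> plan" where
  "Last cs \<equiv> Use cs (Sort []) (Sort []) (Sort [])"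

text \<open>If the first weighing compares coins 0, 1, 2 with coins 3, 4, 5, then exchanging these triples
  turns a plan for one unbalanced outcome into one for the other.\<close>

primrec exchange :: "plan \<Rightarrow> plan" where
  "exchange (Sort p) = Sort (map (\<lambda>i. if i < 3 then i + 3 else if i < 6 then i - 3 else i) p)"
| "exchange (Use cs t1 t2 t3) = Use (take 3 (drop 3 cs) @ take 3 cs @ drop 6 cs)
     (exchange t1) (exchange t2) (exchange t3)"

text \<open>These two plans were found by a depth-first search that prefers weighings with evenly
  distributed outcomes and discards states with more than \<open>3 ^ k\<close> cases for \<open>k\<close> remaining
  weighings.\<close>

definition plan_11_heavier :: plan where
  "plan_11_heavier =
    Use [N,N,R,L,R,R,L,L] (Use [L,L,R,L,L,R,R,R] (Use [N,N,R,N,N,N,R,R,L,L,L] (Use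
    [L,L,N,L,R,N,N,R,R,R,R] (Use [L,L,N,N,N,N,R,N,R,R,R] (Last [N,N,N,N,N,N,N,N,L,N,R]) (Last
    [N,N,N,N,N,N,N,N,L,N,R]) (Last [N,N,N,N,N,N,N,N,L,N,R])) (Use [L,L,N,N,R,N,R,L,R,R,R] (Last
    [N,N,N,N,N,N,N,N,L,N,R]) (Last [L,N,N,N,R,N,N,R]) (Last [L,N,R,R,N,N])) (Use
    [L,L,R,N,N,N,N,L,R,R,R] (Last [N,N,N,N,N,N,N,N,L,N,R]) (Last [L,N,R,N,N,N,R]) (Last
    [N,N,N,N,N,N,N,N,L,N,R]))) (Use [L,L,N,R,L,N,N,R,R,R,R] (Use [L,L,L,R,N,N,R,R,R,R,R] (Last
    [L,N,R,R,N,N,N,R]) (Last [N,N,N,N,N,N,N,N,L,N,R]) (Last [L,L,R,R,R,N,N,R])) (Use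
    [L,L,N,N,R,N,R,N,R,R,R] (Last [N,N,N,N,N,N,N,N,L,N,R]) (Last [N,N,N,N,N,N,N,N,L,N,R]) (Last
    [N,N,N,N,N,N,N,N,L,N,R])) (Use [L,L,R,L,R,N,R,R,R,R,R] (Last [N,N,L,N,N,N,R]) (Last
    [N,N,N,N,N,N,N,N,L,N,R]) (Last [N,N,N,N,N,N,N,N,L,N,R]))) (Use [L,L,R,N,R,N,N,R,N,R,R] (Use
    [L,L,N,R,N,N,R,L,R,R,R] (Last [L,L,N,R,N,N,N,R,R]) (Last [N,N,N,N,N,N,N,N,L,N,R]) (Last
    [N,N,N,N,N,N,N,N,L,N,R])) (Use [L,L,N,R,L,N,L,N,R,R,R] (Last [N,N,N,N,N,N,N,N,L,N,R]) (Last
    [N,N,N,N,N,N,N,N,L,N,R]) (Last [L,N,N,N,R,N,N,R,R])) (Use [L,L,N,N,N,N,R,R,R,N,R] (Sort [3])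
    (Last [L,N,L,N,N,N,N,R,N,N,R]) (Last [L,L,N,R,N,N,N,R,N,N,R])))) (Use [L,L,R,N,N,N,R,R,L,L,L]
    (Use [L,N,N,R,N,R,L,L,R,R,R] (Use [L,R,R,N,N,R,L,L,R,R,R] (Last [N,N,N,N,N,N,N,N,L,N,R]) (Last
    [N,N,N,N,N,N,N,N,L,N,R]) (Last [N,N,N,N,N,N,N,N,L,N,R])) (Use [L,L,L,L,N,R,N,N,R,R,R] (Last
    [N,N,N,N,N,N,N,N,L,N,R]) (Last [L,N,R,N,N,N]) (Last [L,R,N,N,N,N])) (Use
    [L,L,R,N,N,N,L,N,R,R,R] (Last [N,N,N,N,N,N,N,N,L,N,R]) (Last [L,R,R,N,N,N]) (Last
    [N,N,N,N,N,N,N,N,L,N,R]))) (Use [L,N,N,L,N,R,N,N,R,R,R] (Use [L,L,L,R,N,N,R,N,R,R,R] (Last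
    [L,R,N,R,N,R]) (Last [N,N,N,N,N,N,N,N,L,N,R]) (Last [L,N,L,L,N,N,R,R])) (Use
    [N,L,L,N,N,N,N,N,R,R,R] (Last [N,N,N,N,N,N,N,N,L,N,R]) (Last [N,N,N,N,N,N,N,N,L,N,R]) (Last
    [N,N,N,N,N,N,N,N,L,N,R])) (Use [L,L,R,L,N,N,N,N,L,R,R] (Last [L,L,L,R,N,N,R,R,L]) (Last
    [N,N,N,N,N,N,N,N,N,L,R]) (Last [N,L,N,R,N,N,N,N,N,N,R]))) (Use [L,R,L,L,N,R,N,N,N,R,R] (Use
    [L,L,R,R,N,R,L,L,R,R,R] (Sort [1]) (Last [N,N,N,N,N,N,N,N,L,N,R]) (Last
    [L,R,N,R,N,R,N,N,N,N,R])) (Use [N,N,L,L,N,N,N,N,L,R,R] (Last [N,L,R,N,N,N,N,N,N,N,R]) (Last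
    [N,L,R,N,N,N,N,N,N,N,R]) (Last [L,L,L,R,N,L,R,R,R,L])) (Use [N,L,L,L,N,R,R,N,R,N,R] (Last
    [L,L,N,R,N,R,N,N,R]) (Last [L,N,R,N,N,N,N,N,N,N,R]) (Last [L,L,N,R,N,R,N,N,R])))) (Use
    [L,N,R,N,N,N,N,R,L,L,R] (Use [L,L,L,N,N,N,R,R,L,R,R] (Use [L,R,L,L,N,N,L,R,R,R] (Last
    [L,N,R,R,N,N,L,N,N,R]) (Last [L,R,N,N,N,N,N,L,R]) (Last [L,L,R,R,N,N,N,L])) (Use
    [L,L,N,N,N,N,L,N,R,R,R] (Last [L,R,N,N,N,N]) (Last [L,N,N,N,N,N,L,R,R]) (Last
    [L,R,N,N,N,N,R,R,R,L,R])) (Use [L,L,N,N,N,N,L,N,R,R,R] (Last [L,R,R,R,N,N,L,N,N,R]) (Last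
    [L,R,L,L,N,N,N,L,R,R]) (Last [L,R,N,N,N,N,N,N,N,N,R]))) (Use [L,L,L,N,N,N,R,R,L,R,R] (Use
    [N,L,L,N,N,N,N,R,R,N,R] (Last [N,N,N,N,N,N,L,R]) (Last [L,R,N,N,N,N]) (Last
    [N,L,N,N,N,N,R,R,L,N,R])) (Use [L,L,N,N,N,N,L,N,N,R,R] (Last [L,N,R,R,N,N,N,N,N,R]) (Last
    [L,N,L,L,N,N,N,R,N,R]) (Last [N,L,L,N,N,N,N,N,N,N,R])) (Use [N,L,L,N,N,N,L,R,R,R,R] (Last
    [L,R,N,N,N,N]) (Last [L,L,L,L,N,N,N,R,N,R,R]) (Last [N,L,R,R,N,N,N,L,N,N,R]))) (Use
    [L,N,L,L,N,N,R,L,R,R,R] (Use [L,N,L,L,N,N,R,R,R,R,R] (Last [L,N,N,N,N,N,N,R,N,R]) (Last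
    [L,R,L,L,N,N,R,R,N,N,R]) (Last [L,R,R,N,N,N,N,L,N,R])) (Use [N,L,L,L,N,N,L,R,R,R,R] (Sort [2])
    (Last [L,R,N,N,N,N,L,N,N,R]) (Last [L,N,N,N,N,N,N,N,N,R])) (Use [L,N,N,N,N,N,N,R,N,R,L] (Last
    [L,N,R,R,N,N,N,R,N,R,L]) (Last [N,L,L,N,N,N,N,R,N,R]) (Last [L,R,R,R,N,N,R,L,N,L,L]))))) (Use
    [L,L,R,N,L,R,R,R] (Use [N,R,N,L,R,L,N,R,L,L,L] (Use [L,L,L,L,R,N,L,N,R,R,R] (Use
    [L,L,L,R,R,R,N,N,R,R,R] (Last [N,N,N,N,N,N,N,N,L,N,R]) (Last [N,N,N,N,N,N,N,N,L,N,R]) (Last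
    [N,N,N,N,N,N,N,N,L,N,R])) (Use [L,N,L,N,L,N,N,N,R,R,R] (Last [N,N,N,N,N,N,N,N,L,N,R]) (Last
    [L,N,R,N,N,R]) (Last [L,R,N,N,N,R])) (Use [L,L,L,R,L,R,R,N,R,R,R] (Last
    [N,N,N,N,N,N,N,N,L,N,R]) (Last [N,N,N,N,N,N,N,N,L,N,R]) (Last [L,N,N,N,R,N,R]))) (Use
    [L,L,R,N,N,N,N,R,R,R,R] (Use [L,N,L,N,R,R,R,N,R,R,R] (Last [L,N,N,R,R,N]) (Last
    [N,N,N,N,N,N,N,N,L,N,R]) (Last [L,N,R,N,N,N,R])) (Use [L,N,N,N,N,N,N,L,R,R,R] (Last
    [N,N,N,N,N,N,N,N,L,N,R]) (Last [N,N,N,N,N,N,N,N,L,N,R]) (Last [N,N,N,N,N,N,N,N,L,N,R])) (Use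
    [N,N,L,N,N,N,R,N,R,R,R] (Last [L,R,N,N,N,N]) (Last [N,N,N,N,N,N,N,N,L,N,R]) (Last
    [N,N,N,N,N,N,N,N,L,N,R]))) (Use [L,R,L,N,L,R,L,R,R,R,R] (Use [L,R,L,R,L,N,R,N,R,R,R] (Last
    [N,N,N,N,N,N,N,N,L,N,R]) (Last [N,N,N,N,N,N,N,N,L,N,R]) (Last [N,N,N,N,N,N,N,N,L,N,R])) (Use
    [L,L,N,N,N,R,N,R,N,R,R] (Last [L,L,N,N,R,R,N,N,R,N,R]) (Sort [0]) (Last
    [N,L,R,N,L,N,N,N,R,N,R])) (Use [L,L,N,N,R,N,N,N,R,R,R] (Last [N,N,N,N,N,N,N,N,L,N,R]) (Last
    [N,N,N,N,N,N,N,N,L,N,R]) (Last [N,N,N,N,N,N,N,N,L,N,R])))) (Use [N,R,R,N,N,L,R,R,L,L,L] (Use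
    [L,N,L,N,N,L,N,R,R,R,R] (Use [L,N,L,N,N,N,R,N,R,R,R] (Last [N,N,N,N,N,N,N,N,L,N,R]) (Last
    [N,N,N,N,N,N,N,N,L,N,R]) (Last [N,N,N,N,N,N,N,N,L,N,R])) (Use [L,L,L,N,N,N,R,L,N,R,R] (Last
    [L,R,N,N,N,N]) (Last [N,L,N,N,N,L,N,N,R]) (Last [N,L,N,N,N,L,N,N,N,N,R])) (Use
    [N,L,L,N,N,L,R,N,R,R,R] (Last [N,N,N,N,N,N,N,N,L,N,R]) (Last [L,R,N,N,N,N,R]) (Last
    [N,N,N,N,N,N,N,N,L,N,R]))) (Use [L,L,L,N,R,R,N,R,R,R,R] (Use [N,N,L,N,N,N,R,N,R,R,R] (Last
    [L,L,R,N,N,N]) (Last [N,N,N,N,N,N,N,N,L,N,R]) (Last [L,R,N,N,N,N])) (Use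
    [L,R,N,N,L,N,L,N,R,R,R] (Last [N,N,N,N,N,N,N,N,L,N,R]) (Last [N,N,N,N,N,N,N,N,L,N,R]) (Last
    [N,N,N,N,N,N,N,N,L,N,R])) (Use [N,N,L,N,R,N,L,R,R,R,R] (Last [N,N,N,N,N,N,N,N,L,N,R]) (Last
    [N,N,N,N,N,N,N,N,L,N,R]) (Last [L,N,N,N,R,N,R]))) (Use [L,N,L,N,L,R,L,L,R,R,R] (Use
    [L,R,N,N,R,N,N,R,N,R,R] (Sort [6]) (Last [L,R,N,N,R,N,R,N,R,N,R]) (Last
    [L,N,N,N,N,N,N,R,R,N,R])) (Use [N,L,L,N,N,N,N,R,R,R,R] (Last [N,N,N,N,N,N,N,N,L,N,R]) (Last
    [N,N,N,N,N,N,N,N,L,N,R]) (Last [N,N,N,N,N,N,N,N,L,N,R])) (Use [L,L,N,N,N,L,N,R,R,R,R] (Last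
    [N,N,N,N,N,N,N,N,L,N,R]) (Last [N,N,N,N,N,N,N,N,L,N,R]) (Last [N,N,N,N,N,N,N,N,L,N,R])))) (Use
    [N,R,R,R,L,N,N,R,L,L,L] (Use [L,R,L,N,N,L,N,R,N,R,R] (Use [N,L,N,N,L,L,N,N,R,N,R] (Last
    [L,R,L,N,L,R,N,N,R,N,R]) (Last [L,N,N,N,R,N,R,N,N,N,R]) (Last [N,N,N,N,N,N,N,N,L,R,R])) (Use
    [L,L,L,N,L,N,N,R,R,R,R] (Last [N,N,N,N,N,N,N,N,L,N,R]) (Last [L,N,L,N,R,N,N,R]) (Last
    [L,L,R,N,R,R,R,L,L])) (Use [L,L,L,N,N,N,L,R,R,R,R] (Last [L,R,L,N,N,R,N,N,R]) (Last
    [L,N,L,N,R,N,N,R,N,N,R]) (Last [L,R,L,N,R,N,R,N,R]))) (Use [N,L,N,N,R,L,R,R,R,R,R] (Use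
    [L,R,N,R,N,L,N,N,L,R,R] (Last [L,N,N,R,N,N,N,N,R]) (Last [L,R,R,L,N,L,N,N,N,N,R]) (Last
    [N,N,N,L,N,N,N,N,N,N,R])) (Use [N,N,L,N,L,R,R,R,R,R,R] (Last [N,L,N,N,N,N,N,R]) (Last
    [N,N,N,N,N,N,N,N,L,N,R]) (Last [N,N,N,N,N,N,N,N,L,N,R])) (Use [L,L,N,R,L,R,R,R,R,R,R] (Last
    [L,R,L,N,R,N,N,R]) (Last [N,N,N,N,N,N,N,N,L,N,R]) (Last [N,N,N,N,N,N,N,N,L,N,R]))) (Use
    [L,L,L,R,R,L,R,R,R,R,R] (Use [L,N,L,N,R,N,R,N,R,R,R] (Last [N,N,N,N,N,N,N,N,L,N,R]) (Last
    [N,N,N,N,N,N,N,N,L,N,R]) (Last [N,N,N,N,N,N,N,N,L,N,R])) (Use [L,N,L,N,L,N,R,R,R,R,R] (Last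
    [N,N,N,N,N,N,N,N,L,N,R]) (Last [N,N,N,N,N,N,N,N,L,N,R]) (Last [N,N,N,N,N,N,N,N,L,N,R])) (Use
    [L,N,L,L,N,L,R,R,R,R,R] (Sort [1]) (Last [N,N,N,N,N,N,N,N,L,N,R]) (Last
    [N,N,N,N,N,N,N,N,L,N,R]))))) (Use [L,N,L,N,R,R,R,R] (Use [L,L,R,R,N,N,N,R] (Use
    [R,L,R,N,N,N,R,N,L,L] (Use [N,L,N,N,N,N,N,N,R,R,L] (Sort [8]) (Last [N,L,N,N,N,N,N,N,N,N,R])
    (Last [L,N,N,N,N,N,N,N,N,R,R])) (Use [L,R,N,N,N,N,N,N,R,R,L] (Last [L,R,R,N,N,N,R,N,N,N,R])
    (Sort [8]) (Last [L,N,N,N,N,N,N,N,N,R,R])) (Use [L,R,R,N,N,N,R,N,R,R,L] (Last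
    [N,L,N,N,N,N,N,N,N,R]) (Sort [10]) (Last [N,L,N,N,N,N,N,N,N,R]))) (Use [L,R,R,N,N,N,N,R,L,L]
    (Use [L,N,N,N,N,N,N,R,R,R,L] (Sort [8]) (Last [L,N,N,N,N,N,N,R,N,N,R]) (Last
    [L,N,N,N,N,N,N,N,N,R,R])) (Use [L,L,R,N,N,N,N,L,R,R,L] (Last [L,R,R,R,N,N,N,L,N,N,R]) (Sort
    [8]) (Last [N,L,N,N,N,N,N,N,N,R,R])) (Use [L,L,N,N,N,N,N,R,R,R,L] (Sort [10]) (Last
    [L,R,R,R,N,N,N,L,N,R]) (Last [L,R,R,R,N,N,N,L,N,R]))) (Use [R,L,N,N,N,N,R,R,L,L] (Use
    [L,N,N,N,N,N,N,R,R,R,L] (Sort [8]) (Last [L,N,N,N,N,N,N,R,N,N,R]) (Last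
    [L,N,N,N,N,N,N,N,N,R,R])) (Use [L,N,N,N,N,N,R,N,R,R,L] (Last [L,N,N,N,N,N,R,N,N,N,R]) (Sort
    [8]) (Last [L,N,N,N,N,N,N,N,N,R,R])) (Use [L,R,L,N,N,N,R,R,R,R,L] (Sort [10]) (Last
    [L,N,N,N,N,N,R,N,N,R]) (Last [L,N,N,N,N,N,R,N,N,R])))) (Use [L,R,L,N,N,R,R,R,L,L,L] (Use
    [N,L,N,N,L,R,L,N,R,R,R] (Use [L,N,R,N,L,N,L,R,R,R,R] (Last [N,N,N,N,N,N,N,N,L,N,R]) (Last
    [N,N,N,N,N,N,N,N,L,N,R]) (Last [N,N,N,N,N,N,N,N,L,N,R])) (Use [L,N,L,N,R,L,L,R,R,R,R] (Last
    [N,N,N,N,N,N,N,N,L,N,R]) (Last [L,N,R,N,N,R,R]) (Last [L,R,R,N,N,L,N,R])) (Use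
    [L,N,N,N,L,N,R,L,R,R,R] (Last [N,N,N,N,N,N,N,N,L,N,R]) (Last [L,L,R,N,N,N,N,R]) (Last
    [N,N,N,N,N,N,N,N,L,N,R]))) (Use [L,L,L,N,L,R,N,R,R,R,R] (Use [L,L,L,N,N,R,R,R,R,R,R] (Last
    [L,N,R,N,N,N,N,R]) (Last [N,N,N,N,N,N,N,N,L,N,R]) (Last [L,N,R,N,R,L,N,R])) (Use
    [N,L,R,N,N,L,R,L,R,R,R] (Last [N,N,N,N,N,N,N,N,L,N,R]) (Last [N,N,N,N,N,N,N,N,L,N,R]) (Last
    [N,N,N,N,N,N,N,N,L,N,R])) (Use [N,N,L,N,N,L,R,N,R,R,R] (Last [L,N,L,N,N,R,L,R]) (Last
    [N,N,N,N,N,N,N,N,L,N,R]) (Last [N,N,N,N,N,N,N,N,L,N,R]))) (Use [N,L,L,N,R,L,L,R,R,R,R] (Use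
    [L,N,R,N,N,L,L,R,R,R,R] (Last [N,N,N,N,N,N,N,N,L,N,R]) (Last [N,N,N,N,N,N,N,N,L,N,R]) (Last
    [N,N,N,N,N,N,N,N,L,N,R])) (Use [L,L,R,N,R,R,R,L,R,R,R] (Last [N,N,N,N,N,N,N,N,L,N,R]) (Last
    [N,N,N,N,N,N,N,N,L,N,R]) (Last [N,N,N,N,N,N,N,N,L,N,R])) (Use [L,R,L,N,L,R,R,N,N,R,R] (Sort
    [1]) (Last [L,R,R,N,L,R,N,R,R,N,R]) (Last [L,L,R,N,N,N,N,R,R,N,R])))) (Use [L,L,R,L,R,R,N,R]
    (Use [R,N,N,N,N,R,N,N,L,L] (Use [R,L,R,R,R,N,R,N,R,R,L] (Sort [8]) (Last
    [L,R,L,L,L,N,N,N,R,R,R]) (Last [N,L,N,N,N,N,N,N,N,R,R])) (Use [L,N,N,N,N,R,N,N,R,R,L] (Last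
    [L,N,N,N,N,R,N,N,N,N,R]) (Sort [8]) (Last [L,N,N,N,N,N,N,N,N,R,R])) (Use
    [L,R,L,N,N,R,N,N,R,R,L] (Sort [8]) (Last [L,R,L,N,N,N,N,N,N,N,R]) (Last
    [L,R,L,N,N,N,N,N,N,R,R]))) (Use [N,R,N,N,N,N,N,R,L,L] (Use [N,N,L,N,N,N,N,R,R,R,L] (Sort [8])
    (Last [N,N,L,N,N,N,N,R,N,N,R]) (Last [N,N,L,N,N,N,N,N,N,R,R])) (Use [N,R,L,N,N,N,N,N,R,R,L]
    (Last [N,L,R,N,N,N,N,N,N,N,L]) (Sort [8]) (Last [N,L,N,N,N,N,N,N,N,R,R])) (Use
    [N,L,L,N,N,N,N,R,R,R,L] (Sort [10]) (Last [N,N,N,N,N,N,N,N,L,R]) (Last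
    [N,N,N,N,N,N,N,N,L,R]))) (Use [L,R,N,N,N,R,R,N,L,L] (Use [L,N,N,N,N,R,N,N,R,R,L] (Sort [8])
    (Last [L,N,N,N,N,R,N,N,N,N,R]) (Last [L,N,N,N,N,N,N,N,N,R,R])) (Use [N,L,N,N,N,N,R,N,R,R,L]
    (Last [L,R,R,L,N,L,R,N,N,N,R]) (Sort [8]) (Last [N,L,N,N,N,N,N,N,N,R,R])) (Use
    [R,L,L,N,N,R,R,N,R,R,L] (Sort [10]) (Last [L,R,R,L,N,L,R,N,N,R]) (Last
    [L,R,R,L,N,L,R,L,N,R,R])))))"

definition plan_11_balanced :: plan where
  "plan_11_balanced =
    Use [L,N,N,L,R,R] (Use [N,L,R,N,R,R,L] (Use [N,N,N,R,N,R,R,L,L,L,L] (Use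
    [N,L,N,L,L,L,R,L,R,R,R] (Use [L,L,N,N,L,N,N,N,R,R,R] (Last [N,N,N,N,N,N,N,N,L,N,R]) (Last
    [N,N,N,N,N,N,N,N,L,N,R]) (Last [N,N,N,N,N,N,N,N,L,N,R])) (Use [L,N,N,L,N,N,L,N,R,R,R] (Last
    [N,N,N,N,N,N,N,N,L,N,R]) (Last [N,L,N,N,N,N,R,R]) (Last [L,R,N,N,R,N,N,R])) (Use
    [N,L,N,L,R,R,L,N,R,R,R] (Last [N,N,N,N,N,N,N,N,L,N,R]) (Last [L,R,N,N,N,R,L]) (Last
    [N,N,N,N,N,N,N,N,L,N,R]))) (Use [L,L,N,N,R,L,R,N,R,R,R] (Use [L,R,N,R,N,L,L,R,L,R,R] (Last
    [L,N,N,N,N,N,N,R,R]) (Last [L,R,N,R,N,L,L,N,N,N,R]) (Last [N,N,N,N,N,N,N,L,N,N,R])) (Use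
    [L,R,N,L,N,N,N,N,R,R,R] (Last [N,N,N,N,N,N,N,N,L,N,R]) (Last [N,N,N,N,N,N,N,N,L,N,R]) (Last
    [N,N,N,N,N,N,N,N,L,N,R])) (Use [L,L,N,N,R,R,N,R,R,R,R] (Last [L,R]) (Last
    [N,N,N,N,N,N,N,N,L,N,R]) (Last [L,R]))) (Use [L,R,N,L,R,L,L,N,R,R,R] (Use
    [L,R,N,L,N,R,N,N,R,R,R] (Last [N,N,N,N,N,N,N,N,L,N,R]) (Last [N,N,N,N,N,N,N,N,L,N,R]) (Last
    [N,N,N,N,N,N,N,N,L,N,R])) (Use [L,L,N,L,N,N,R,N,R,R,R] (Last [N,N,N,N,N,N,N,N,L,N,R]) (Last
    [N,N,N,N,N,N,N,N,L,N,R]) (Last [N,N,N,N,N,N,N,N,L,N,R])) (Use [L,L,N,N,L,L,N,R,R,R,R] (Last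
    [N,N,N,N,N,N,N,N,L,N,R]) (Last [N,N,N,N,N,N,N,N,L,N,R]) (Sort [0])))) (Use
    [L,N,R,R,N,R,R,L,L,L,L] (Use [N,N,L,L,R,N,N,L,R,R,R] (Use [N,N,L,L,N,R,N,N,R,R,R] (Last
    [N,N,N,N,N,N,N,N,L,N,R]) (Last [N,N,N,N,N,N,N,N,L,N,R]) (Last [N,N,N,N,N,N,N,N,L,N,R])) (Use
    [L,N,L,L,N,N,N,R,R,R,R] (Last [N,N,N,N,N,N,N,N,L,N,R]) (Last [L,N,R,R,L,N,R,L]) (Last
    [N,N,N,N,L,R,R])) (Use [L,N,L,L,N,R,R,N,R,R,R] (Last [N,N,N,N,N,N,N,N,L,N,R]) (Last
    [L,N,R,N,N,L,R]) (Last [N,N,N,N,N,N,N,N,L,N,R]))) (Use [L,N,N,N,R,N,N,L,R,R,R] (Use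
    [L,N,L,N,N,N,R,R,R,R,R] (Last [N,N,N,N,N,N,L,R]) (Last [N,N,N,N,N,N,N,N,L,N,R]) (Last
    [L,N,R,N,N,R,L])) (Use [N,N,L,L,R,R,N,N,R,R,R] (Last [N,N,N,N,N,N,N,N,L,N,R]) (Last
    [N,N,N,N,N,N,N,N,L,N,R]) (Last [N,N,N,N,N,N,N,N,L,N,R])) (Use [L,N,L,N,N,R,R,N,R,R,R] (Last
    [L,N,R,N,L,N,R]) (Last [N,N,N,N,N,N,N,N,L,N,R]) (Last [N,N,N,N,N,N,N,N,L,N,R]))) (Use
    [N,N,N,N,L,R,N,L,L,R,R] (Use [L,N,N,N,L,L,R,N,R,R,R] (Last [L,N,N,N,N,R,N,N,R]) (Last
    [L,N,R,R,L,N,L,R,N,N,R]) (Last [N,N,N,N,N,N,N,N,L,N,R])) (Use [L,N,L,N,R,N,N,L,R,R,R] (Last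
    [L,N,N,N,N,N,R,N,N,N,R]) (Last [N,N,L,N,R,R,N,N,R]) (Last [N,N,N,N,N,N,N,N,L,N,R])) (Use
    [N,N,L,L,R,R,R,R,R,N,R] (Last [L,N,N,N,N,N,N,N,R]) (Sort [9]) (Last [L,N,N,N,N,N,N,N,R]))))
    (Use [L,L,R,R,R,R,R,L] (Use [N,R,N,N,N,R,N,N,L,L] (Use [L,R,N,N,R,N,N,N,R,R,L] (Sort [8])
    (Last [L,R,N,L,R,N,N,N,N,N,R]) (Last [L,N,N,N,N,N,N,N,N,R,R])) (Use [L,N,N,N,N,R,N,N,R,R,L]
    (Last [L,N,N,N,N,R,N,N,N,N,R]) (Sort [8]) (Last [L,N,N,N,N,N,N,N,N,R,R])) (Use
    [N,L,N,N,N,R,N,N,R,R,L] (Last [L,R,N,L,R,N,N,N,N,R]) (Sort [10]) (Last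
    [L,R,N,L,R,N,N,N,N,R]))) (Sort [7]) (Use [N,R,N,N,N,R,N,N,L,L] (Use [L,R,N,N,R,N,N,N,R,R,L]
    (Sort [8]) (Last [L,R,N,L,R,N,N,N,N,N,R]) (Last [L,N,N,N,N,N,N,N,N,R,R])) (Use
    [L,N,N,N,N,R,N,N,R,R,L] (Last [L,N,N,N,N,R,N,N,N,N,R]) (Sort [8]) (Last
    [L,N,N,N,N,N,N,N,N,R,R])) (Use [N,L,N,N,N,R,N,N,R,R,L] (Last [L,R,N,L,R,N,N,N,N,R]) (Sort
    [10]) (Last [L,R,N,L,R,N,N,N,N,R]))))) (Use [R,L,L,N,R,R,L] (Use [N,L,N,N,N,R,R,L,L,L,R] (Use
    [N,L,L,N,R,R,L,L,R,R,R] (Use [N,L,R,N,L,R,N,N,N,R] (Last [N,N,N,N,N,N,N,N,L,R]) (Last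
    [N,L,L,N,N,L,R,R]) (Last [N,L,L,N,N,L,R,R])) (Use [N,L,L,N,L,N,R,R,N,N,R] (Last [N,L,R]) (Last
    [N,L,N,N,L,R,R]) (Last [N,L,R,N,R,R,L,R,N,N,R])) (Use [N,L,L,N,L,N,N,R,N,R,R] (Last
    [N,L,R,N,N,R,N,R,N,R]) (Last [N,L,R,N,L,L,R,R,N,N,L]) (Last [N,L,R,N,N,N,N,N,N,N,R]))) (Use
    [N,L,L,N,L,L,R,N,R,R,R] (Use [N,L,L,N,R,N,N,R,R,R,R] (Last [N,L,N,N,L,R]) (Last
    [N,N,N,N,N,N,N,L,N,R]) (Last [N,L,L,N,R,R,N,R,N,N,L])) (Use [N,L,N,N,R,L,N,R,N,R] (Last
    [N,L,R,N,N,N,N,N,N,R]) (Last [N,N,L,N,R,R,L,R,N,R]) (Last [N,N,L,N,N,N,N,L,R,R])) (Use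
    [N,N,L,N,N,L,N,R,R,R,R] (Last [N,N,N,N,N,N,N,N,L,N,R]) (Last [N,L,L,N,L,R,R,R]) (Last
    [N,L,L,N,L,N,R,R]))) (Use [N,N,N,N,L,R,L,L,R,R,R] (Use [N,L,L,N,N,L,N,R,R,R,R] (Last
    [N,L,R,N,R,R,L,R]) (Last [N,L,N,N,N,N,N,N,N,R]) (Last [N,N,N,N,N,N,N,L,N,R])) (Use
    [N,L,L,N,L,L,N,N,R,R,R] (Last [N,L,R,N,R,N,N,N,N,R,R]) (Last [N,L,L,N,L,N,R,R]) (Last
    [N,L,R,N,N,R,R,L,N,R,L])) (Use [N,L,L,N,L,L,R,R,N,R,R] (Last [N,L,N,N,N,N,N,R,N,R,R]) (Sort
    [1]) (Last [N,L,R,N,L,N,R,N,R,R,L])))) (Sort [1,6]) (Use [N,L,N,N,N,R,N,L,L,R,R] (Use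
    [N,L,L,N,R,R,N,L,R,L,R] (Use [N,L,L,N,L,N,N,R,R,R] (Last [N,L,R]) (Last [N,L,N,N,L,R,N,R])
    (Last [N,L,R,N,R,R,N,L,R,R])) (Use [N,L,L,N,L,N,N,R,R,N,R] (Last [N,L,R]) (Last
    [N,L,N,N,L,R,N,R]) (Last [N,L,R,N,R,R,N,R,L,N,R])) (Use [N,L,N,N,L,R,N,N,R,R,R] (Last
    [N,L,N,N,N,N,N,R,N,N,R]) (Last [N,L,R,N,L,L,N,R,R,L]) (Last [N,N,L,N,R,R,N,L,N,R]))) (Use
    [N,L,L,N,R,R,N,L,R,L,R] (Use [N,L,L,N,N,L,N,R,N,R,R] (Last [N,L,N,N,L,R]) (Last
    [N,N,L,N,L,N,N,R]) (Last [N,N,L,N,R,R,N,R,N,L])) (Use [N,L,L,N,N,L,N,N,R,R,R] (Last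
    [N,L,N,N,L,R]) (Last [N,N,L,N,L,N,N,N,R]) (Last [N,N,L,N,R,R,N,N,R,N,L])) (Use
    [N,L,L,N,N,L,N,N,R,R,R] (Last [N,L,N,N,L,N,N,R,N,N,R]) (Last [N,N,L,N,L,L,N,L,N,R,R]) (Last
    [N,N,L,N,N,N,N,N,N,N,R]))) (Use [N,L,R,N,R,L,N,L,N,N,R] (Use [N,L,R,N,R,L,N,N,R,R,R] (Last
    [N,L,N,N,N,N,N,R,N,N,R]) (Last [N,L,L,N,R,N,N,N,R,N,R]) (Last [N,L,R,N,N,R,N,R,L,N,R])) (Use
    [N,N,L,N,L,R,N,N,R,R,R] (Last [N,N,L,N,N,N,N,R,N,N,R]) (Last [N,L,L,N,N,R,N,R,N,R]) (Last
    [N,N,L,N,R,N,N,N,L,N,R])) (Use [N,L,N,N,L,N,N,R,R,R] (Last [N,L,R,N,L,R,N,R,N,R,R]) (Last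
    [N,L,N,N,L,N,N,R,N,L,R]) (Sort [2]))))) (Use [N,L,L,N,R,R] (Sort [4]) (Sort [4]) (Sort [0]))"

lemma table_ok_11: "table_ok d TYPE('a) [0, 1, 2, 3, 3, 4, 4, 5, 6, 6, 7, 7]"
proof -
  note add = table_ok_snoc_add[of d, where 'a = 'a]
  note plan = table_ok_snoc_plan[of d, where 'a = 'a]
  have "works [0] (Last [L]) 1 0 1 [[]]" by code_simp
  from plan[OF table_ok_zero _ this] have "table_ok d TYPE('a) [0, 1]" by simp
  from add[OF this, of 1 1] have "table_ok d TYPE('a) [0, 1, 2]"
    by (simp add: eval_nat_numeral)
  from add[OF this, of 1 2] have 3: "table_ok d TYPE('a) [0, 1, 2, 3]"
    by (simp add: eval_nat_numeral)
  \<comment> \<open>After the second weighing at most two patterns of the four coins remain, told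
    apart by a single coin.\<close>
  have "works [0, 1, 2, 3]
    (Use [L,L,R,R] (Use [L,R,N,R] (Sort []) (Sort [0]) (Sort [2])) (Use [L,R,L,R] (Sort [0]) (Sort
    [1]) (Sort [])) (Use [N,N,L,R] (Sort [0]) (Sort [0]) (Sort [0])))
    3 0 4 [[]]"
    by code_simp
  from plan[OF 3 _ this] have "table_ok d TYPE('a) [0, 1, 2, 3, 3]" by simp
  from add[OF this, of 1 4] have 5: "table_ok d TYPE('a) [0, 1, 2, 3, 3, 4]" by simp
  have "works [0, 1, 2, 3, 3, 4]
    (Use [L,L,R,R] (Use [L,R,L,R,L,R] (Use [L,L,R,N,R,R] (Last [L,R,N,N,R]) (Sort [1]) (Sort [1]))
    (Use [L,L,N,R,R,R] (Last [N,N,N,L,N,R]) (Sort [0]) (Sort [0])) (Use [L,N,L,N,R,R] (Sort [2])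
    (Sort [0]) (Sort [1]))) (Use [L,R,L,R,L,R] (Use [L,N,L,R,R,R] (Sort [0]) (Last [N,N,N,L,N,R])
    (Sort [0])) (Use [N,L,L,N,R,R] (Sort [5]) (Sort [4]) (Last [N,L,L,R])) (Use [L,N,L,N,R,R]
    (Sort [0]) (Sort [2]) (Sort [1]))) (Use [N,N,L,R] (Use [L,R,R,N,L,L] (Last [N,N,N,N,L,R])
    (Last [N,N,N,N,L,R]) (Sort [0])) (Use [L,R,N,R,L,L] (Last [N,N,N,N,L,R]) (Last [N,N,N,N,L,R])
    (Sort [0])) (Use [R,R,N,N,L,L] (Last [N,N,N,N,L,R]) (Last [N,N,N,N,L,R]) (Sort [0]))))
    4 0 6 [[]]"
    by code_simp
  from plan[OF 5 _ this] have "table_ok d TYPE('a) [0, 1, 2, 3, 3, 4, 4]" by simp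
  from add[OF this, of 1 6] have "table_ok d TYPE('a) [0, 1, 2, 3, 3, 4, 4, 5]" by simp
  from add[OF this, of 2 6] have 8: "table_ok d TYPE('a) [0, 1, 2, 3, 3, 4, 4, 5, 6]" by simp
  \<comment> \<open>The plan for four coins again: two weighings leave at most one of them open.
    With the five unweighed coins at most six remain, for which 4 weighings suffice.\<close>
  have "works [0, 1, 2, 3, 3, 4, 4, 5, 6]
    (Use [L,L,R,R] (Use [L,R,N,R] (Sort []) (Sort [0]) (Sort [2])) (Use [L,R,L,R] (Sort [0]) (Sort
    [1]) (Sort [])) (Use [N,N,L,R] (Sort [0]) (Sort [0]) (Sort [0])))
    6 0 9 [[]]"
    by code_simp
  from plan[OF 8 _ this] have "table_ok d TYPE('a) [0, 1, 2, 3, 3, 4, 4, 5, 6, 6]" by simp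
  from add[OF this, of 1 9] have 10: "table_ok d TYPE('a) [0, 1, 2, 3, 3, 4, 4, 5, 6, 6, 7]"
    by simp
  \<comment> \<open>Three coins against three leave 22, 22 and 20 of the 64 patterns. With five
    unweighed coins these are 704, 704 and 640 sets of fakes, within the \<open>3 ^ 6\<close> = 729
    outcomes of six weighings.\<close>
  have "works [0, 1, 2, 3, 3, 4, 4, 5, 6, 6, 7]
    (Use [L,L,L,R,R,R] plan_11_heavier (exchange plan_11_heavier) plan_11_balanced) 7 0 11 [[]]"
    by code_simp
  from plan[OF 10 _ this] show ?thesis by simp
qed

section \<open>From 11 and 14 coins to all numbers of coins\<close>

lemma solvable_14:
  assumes "finite S" "card S = 14"
  shows "solvable d S 9 (Pow S)"
proof -
  \<comment> \<open>Two weighings leave at most one of the first four coins open. With the ten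
    unweighed coins at most 11 remain, for which 7 weighings suffice.\<close>
  have "works [0, 1, 2, 3, 3, 4, 4, 5, 6, 6, 7, 7]
    (Use [L,L,R,R] (Use [L,R,L,R] (Sort [1]) (Sort [0]) (Sort []))
      (Use [L,R,L,R] (Sort [0]) (Sort [1]) (Sort []))
      (Use [L,R] (Sort [2]) (Sort [2]) (Sort [0])))
    9 0 14 [[]]"
    by code_simp
  then have "works [0, 1, 2, 3, 3, 4, 4, 5, 6, 6, 7, 7]
    (Use [L,L,R,R] (Use [L,R,L,R] (Sort [1]) (Sort [0]) (Sort []))
      (Use [L,R,L,R] (Sort [0]) (Sort [1]) (Sort []))
      (Use [L,R] (Sort [2]) (Sort [2]) (Sort [0])))
    9 0 (card S) [[]]"
    using assms(2) by (simp only:)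
  then show ?thesis by (rule solvable_by_plan[OF table_ok_11 _ assms(1)])
qed

lemma solvable_11_mult:
  fixes S :: "'a set"
  assumes "\<And>A :: 'a set. finite A \<Longrightarrow> card A = i \<Longrightarrow> solvable d A k (Pow A)"
    and "finite S" "card S = 11 * q + i"
  shows "solvable d S (7 * q + k) (Pow S)"
  using assms(2,3)
proof (induction q arbitrary: S)
  case (Suc q)
  have "solvable d A 7 (Pow A)" if "finite A" "card A = 11" for A :: "'a set"
    using table_okD[OF table_ok_11 that] by simp
  from solvable_add[OF this Suc.IH, of 11 "11 * q + i" S] Suc.prems
  show ?case by (simp add: algebra_simps)
qed (use assms(1) in simp)

text \<open>For each remainder \<open>r\<close> other than 3 the table entry is the ceiling of
  7r/11; adding 11 coins and 7 weighings preserves this.\<close>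

lemma solvable_ceiling:
  fixes S :: "'a set"
  assumes "finite S" "card S \<noteq> 3"
  shows "\<exists>k. solvable d S k (Pow S) \<and> int k \<le> \<lceil>7 * real (card S) / 11\<rceil>"
proof -
  define q r where "q = card S div 11" and "r = card S mod 11"
  have card: "card S = 11 * q + r" and r: "r < 11" by (auto simp: q_def r_def)
  \<comment> \<open>An integer is at most the ceiling of x iff it is less than x + 1; clearing the
    denominator, the multiples of \<open>p\<close> cancel.\<close>
  have ceil: "int (7 * p + k) \<le> \<lceil>7 * real (card S) / 11\<rceil>"
    if "card S = 11 * p + i" "11 * k < 7 * i + 11" for p k i
    using that by (simp add: le_ceiling_iff field_simps)
  show ?thesis
  proof (cases "r = 3")
    case True
    \<comment> \<open>\<open>card S\<close> is not 3, so there is a block of 11 coins to merge with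
      the remainder 3. For 14 coins, 9 is the ceiling of 98/11.\<close>
    then obtain p where "q = Suc p" using card assms(2) by (cases q) auto
    then have S: "card S = 11 * p + 14" using card True by simp
    then have "solvable d S (7 * p + 9) (Pow S)"
      by (intro solvable_11_mult[OF solvable_14] assms(1))
    then show ?thesis using ceil[OF S, of 9] by (intro exI[of _ "7 * p + 9"]) simp
  next
    case False
    define k where "k = [0, 1, 2, 3, 3, 4, 4, 5, 6, 6, 7, 7 :: nat] ! r"
    have "solvable d A k (Pow A)" if "finite A" "card A = r" for A :: "'a set"
      using table_okD[OF table_ok_11 that] r by (simp add: k_def)
    then have "solvable d S (7 * q + k) (Pow S)"
      by (rule solvable_11_mult) (use assms(1) card in auto)
    moreover have "r \<in> {0, 1, 2, 4, 5, 6, 7, 8, 9, 10}"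
      using r False unfolding insert_iff empty_iff by arith
    then have "11 * k < 7 * r + 11" by (auto simp: k_def)
    ultimately show ?thesis using ceil[OF card] by blast
  qed
qed

section \<open>The least number of weighings\<close>

lemma min_weighings_le:
  assumes "solvable d S k (Pow S)"
  shows "min_weighings d S \<le> k"
  unfolding min_weighings_def by (rule Least_le) (use assms in \<open>simp add: solvable_Pow\<close>)

text \<open>\<open>LEAST\<close> has the required property once some bound exists; the assumption
  provides one.\<close>

lemma sorts_within_min_weighings:
  assumes "solvable d S k (Pow S)"
  shows "\<exists>t. sorts_within d S (min_weighings d S) t"
  unfolding min_weighings_def by (rule LeastI[of _ k]) (use assms in \<open>simp add: solvable_Pow\<close>)

theorem proposition1:
  fixes S :: "'a set" and n :: nat and d :: bias
  assumes "finite S" and "card S = n" and "n \<ge> 1"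
  shows "(n \<noteq> 3 \<longrightarrow>
            \<lceil>real n * log 3 2\<rceil> \<le> int (min_weighings d S) \<and>
            int (min_weighings d S) \<le> \<lceil>7 * real n / 11\<rceil>) \<and>
         (n = 3 \<longrightarrow> min_weighings d S = 3)"
proof (intro conjI impI)
  assume "n \<noteq> 3"
  then obtain k where k: "solvable d S k (Pow S)" "int k \<le> \<lceil>7 * real n / 11\<rceil>"
    using solvable_ceiling[of S d] assms by auto
  show "int (min_weighings d S) \<le> \<lceil>7 * real n / 11\<rceil>"
    using min_weighings_le[OF k(1)] k(2) by linarith
  obtain t where "sorts_within d S (min_weighings d S) t"
    using sorts_within_min_weighings[OF k(1)] by blast
  then have "2 ^ n \<le> (3 :: nat) ^ min_weighings d S"
    using sorts_within_imp_power_le assms by blast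
  then have "real (2 ^ n) \<le> real (3 ^ min_weighings d S)" by (rule of_nat_mono)
  then have "(2 :: real) ^ n \<le> 3 ^ min_weighings d S" by simp
  from log_mono[OF _ _ this, of 3] have "real n * log 3 2 \<le> real (min_weighings d S)"
    by (simp add: log_nat_power)
  then show "\<lceil>real n * log 3 2\<rceil> \<le> int (min_weighings d S)" by (simp add: ceiling_le_iff)
next
  assume n: "n = 3"
  then have 3: "solvable d S 3 (Pow S)"
    using table_okD[OF table_ok_11, of S 3] assms(1,2) by simp
  obtain t where t: "sorts_within d S (min_weighings d S) t"
    using sorts_within_min_weighings[OF 3] by blast
  have "\<not> min_weighings d S \<le> 2"
  proof
    assume "min_weighings d S \<le> 2"
    moreover have "solvable d S (min_weighings d S) (Pow S)" using t by (auto simp: solvable_Pow)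
    ultimately have "solvable d S 2 (Pow S)" by (rule solvable_mono[rotated])
    then show False using not_sorts_within_2[of S d] assms n by (auto simp: solvable_Pow)
  qed
  then show "min_weighings d S = 3" using min_weighings_le[OF 3] by linarith
qed

end
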